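(* Let $\alpha>0$, $\delta>0$, let $n$ be a positive integer, and let $X_{(1,n)}\le X_{(2,n)}\le\dots\le X_{(n,n)}$ be the order statistics of $n$ independent observations on a random variable $X\in Par(\alpha,\delta)$. Let $1\le i<j\le n$ be integers. (i) Let $\rho$ be a Beta distributed random variable with parameters $n-j+1$ and $j-i$. Then $$\log\left(\frac{X_{(j,n)}}{X_{(i,n)}}\right)\stackrel{d}{=}-\frac{1}{\alpha}\log(\rho)\stackrel{d}{=}E_{(j-i,n-i)}\stackrel{d}{=}\frac{1}{\alpha}E^*_{(j-i,n-i)},$$ where $E_{(j-i,n-i)}$ is the $(j-i)$-th order statistic of a sample of $n-i$ independent exponential random variables with parameter $\alpha$, and $E^*_{(j-i,n-i)}$ is the $(j-i)$-th order statistic of a sample of $n-i$ independent exponential random variables with parameter $1$. The probability density function of $\log\frac{X_{(j,n)}}{X_{(i,n)}}$ is $$f_{\log\frac{X_{(j,n)}}{X_{(i,n)}}}(x)=\frac{\alpha\,(n-i)!}{(j-i-1)!\,(n-j)!}\left(1-e^{-\alpha x}\right)^{j-i-1}e^{-\alpha x(n-j+1)},\qquad x>0.$$ (ii) The mean and variance are $$\mathbb{E}\left[\log\frac{X_{(j,n)}}{X_{(i,n)}}\right]=\frac{1}{\alpha}\left(H_{n-i}-H_{n-j}\right),\qquad \mathbb{D}\left[\log\frac{X_{(j,n)}}{X_{(i,n)}}\right]=\frac{1}{\alpha^2}\left(H_{n-i,2}-H_{n-j,2}\right).$$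
   Context: $X\in Par(\alpha,\delta)$ means that $X$ has c.d.f. $F_X(x)=0$ for $x\le\delta$ and $F_X(x)=1-(\delta/x)^{\alpha}$ for $x>\delta$. The exponential distribution with parameter $\lambda>0$ has c.d.f. $1-e^{-\lambda x}$ for $x>0$ and $0$ for $x\le 0$. Order statistics are increasing: the $m$-th order statistic is the $m$-th smallest value in the sample. $\stackrel{d}{=}$ is equality in distribution, $\mathbb{E}$ is expectation, $\mathbb{D}$ is variance, $\log$ is the natural logarithm. $H_{n,m}=\sum_{r=1}^{n} r^{-m}$ is the generalized harmonic number of power $m$, $H_n=H_{n,1}$, with $H_{0}=H_{0,2}=0$. *)

theory Defs
  imports "HOL-Probability.Probability" "HOL-Analysis.Harmonic_Numbers"
begin

definition pareto_distributed :: "'a measure \<Rightarrow> ('a \<Rightarrow> real) \<Rightarrow> real \<Rightarrow> real \<Rightarrow> bool" where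
  "pareto_distributed M X \<alpha> \<delta> \<longleftrightarrow>
     X \<in> borel_measurable M \<and>
     (\<forall>x. cdf (distr M borel X) x = (if x \<le> \<delta> then 0 else 1 - (\<delta> / x) powr \<alpha>))"

definition exp_distributed :: "'a measure \<Rightarrow> ('a \<Rightarrow> real) \<Rightarrow> real \<Rightarrow> bool" where
  "exp_distributed M X l \<longleftrightarrow>
     X \<in> borel_measurable M \<and>
     (\<forall>x. cdf (distr M borel X) x = (if x \<le> 0 then 0 else 1 - exp (- l * x)))"

lemma exp_distributed_iff_exponential_density:
  assumes "prob_space M" and l: "0 < l"
  shows "exp_distributed M X l \<longleftrightarrow> distributed M lborel X (exponential_density l)"
proof -
  interpret prob_space M by fact
  have cdf_eq: "cdf (distr M borel X) a = \<P>(x in M. X x \<le> a)"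
    if "X \<in> borel_measurable M" for a
    using that by (auto simp: cdf_def measure_distr vimage_def Int_def intro!: arg_cong[where f = prob])
  show ?thesis
  proof
    assume E: "exp_distributed M X l"
    then have X: "X \<in> borel_measurable M" by (simp add: exp_distributed_def)
    have "\<P>(x in M. X x \<le> a) = 1 - exp (- a * l)" if "0 \<le> a" for a
      using E that cdf_eq[OF X, of a] by (cases "a = 0") (auto simp: exp_distributed_def mult.commute[of l])
    with X l show "distributed M lborel X (exponential_density l)"
      by (simp add: exponential_distributed_iff)
  next
    assume D: "distributed M lborel X (exponential_density l)"
    with l have X: "X \<in> borel_measurable M"
      and P: "\<And>a. 0 \<le> a \<Longrightarrow> \<P>(x in M. X x \<le> a) = 1 - exp (- a * l)"
      by (auto simp: exponential_distributed_iff)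
    have "cdf (distr M borel X) a = 0" if "a \<le> 0" for a
    proof -
      have "\<P>(x in M. X x \<le> a) \<le> \<P>(x in M. X x \<le> 0)"
        using that X by (intro finite_measure_mono) auto
      with P[of 0] show ?thesis
        by (simp add: cdf_eq[OF X] measure_le_0_iff)
    qed
    moreover have "cdf (distr M borel X) a = 1 - exp (- l * a)" if "\<not> a \<le> 0" for a
      using P[of a] that by (simp add: cdf_eq[OF X] mult.commute)
    ultimately show "exp_distributed M X l"
      using X by (simp add: exp_distributed_def)
  qed
qed

definition beta_density :: "real \<Rightarrow> real \<Rightarrow> real \<Rightarrow> real" where
  "beta_density a b x =
     (if 0 < x \<and> x < 1 then x powr (a - 1) * (1 - x) powr (b - 1) / Beta a b else 0)"

text \<open>The \<open>m\<close>-th smallest value, with \<open>m\<close> counted from 1, in the sample \<open>X 1 \<omega>, \<dots>, X n \<omega>\<close>.\<close>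

definition order_stat :: "(nat \<Rightarrow> 'a \<Rightarrow> real) \<Rightarrow> nat \<Rightarrow> nat \<Rightarrow> 'a \<Rightarrow> real" where
  "order_stat X m n \<omega> = sort (map (\<lambda>k. X k \<omega>) [1..<Suc n]) ! (m - 1)"

text \<open>The measurability conjuncts matter: \<^term>\<open>distr M borel X\<close> is not the law of \<open>X\<close>
  when \<open>X\<close> is not measurable.\<close>

definition eq_in_distr :: "'a measure \<Rightarrow> ('a \<Rightarrow> real) \<Rightarrow> 'b measure \<Rightarrow> ('b \<Rightarrow> real) \<Rightarrow> bool" where
  "eq_in_distr M X N Y \<longleftrightarrow>
     X \<in> borel_measurable M \<and> Y \<in> borel_measurable N \<and> distr M borel X = distr N borel Y"

definition gen_harm :: "nat \<Rightarrow> nat \<Rightarrow> real" where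
  "gen_harm n m = (\<Sum>r=1..n. 1 / real r ^ m)"

lemma gen_harm_1: "gen_harm n 1 = harm n"
  by (simp add: gen_harm_def harm_def inverse_eq_divide)

end

theory Submission
  imports Defs "HOL-Real_Asymp.Real_Asymp"
begin

text \<open>Condition on which observation \<open>X k = t\<close> has rank \<open>i\<close> and on the set \<open>S\<close> of the \<open>i - 1\<close> observations
  below it. By the memorylessness of the Pareto tail, each of the remaining \<open>n - i\<close> observations
  independently lies in \<open>(t, e\<^sup>x t]\<close> with conditional probability \<open>p = 1 - e\<^sup>-\<^sup>\<alpha>\<^sup>x\<close>, whatever \<open>t\<close> is. Hence
  \<open>X\<^bsub>(j,n)\<^esub> \<le> e\<^sup>x X\<^bsub>(i,n)\<^esub>\<close> has the probability that a binomial variable with parameters \<open>n - i\<close>, \<open>p\<close>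
  is at least \<open>j - i\<close>. The same binomial tail is the distribution function of the exponential order
  statistics, and its derivative in \<open>p\<close> is a Beta density. Integration by parts gives a
  recursion in \<open>j\<close> for the moments.\<close>

subsection \<open>Order statistics\<close>

text \<open>For a continuous law the event \<open>X k = t\<close> is null, so the conditioning is
  carried out on the product measure \<open>sample\<close>: Fubini integrates the pivot coordinate
  over \<open>t\<close>, and each slice is a finite disjoint union of boxes. A pivot must exist at
  almost every point, so ties have to be null; this is why the law is taken to be atomless. The
  probability of a single pivot event is not evaluated: once the binomial tail is split off, the
  remaining constant does not depend on \<open>j\<close> and is fixed by a case of total mass 1.
  Memorylessness enters through an abstract map \<open>h\<close>: the mass beyond \<open>h t\<close>
  is the share \<open>1 - p\<close> of the mass beyond \<open>t\<close>. The equalities in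
  distribution are not proved pairwise. Each variable is shown to have the density
  \<open>spacing_density \<alpha> (n - i) (j - i)\<close>, by evaluating its distribution function
  on the nonnegative half-line. In the moment recursion, with \<open>N = n - i\<close> fixed,
  passing from \<open>m\<close> to \<open>Suc m\<close> adds the mean and the variance of an
  exponential variable with parameter \<open>\<alpha> * (N - m)\<close>, as in the Renyi
  representation.\<close>

lemma sorted_nth_downward_closed_iff:
  fixes xs :: "'a::linorder list"
  assumes "sorted xs" and m: "1 \<le> m" "m \<le> length xs"
    and down: "\<And>x y. P y \<Longrightarrow> x \<le> y \<Longrightarrow> P x"
  shows "P (xs ! (m - 1)) \<longleftrightarrow> m \<le> length (filter P xs)"
proof -
  \<comment> \<open>In a sorted list the entries satisfying a downward closed \<open>P\<close> form
    an initial segment, so it suffices to compare their number with the position.\<close>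
  have len: "length (filter P xs) = card {k. k < length xs \<and> P (xs ! k)}"
    by (rule length_filter_conv_card)
  show ?thesis
  proof
    assume P: "P (xs ! (m - 1))"
    have "{..<m} \<subseteq> {k. k < length xs \<and> P (xs ! k)}"
    proof
      fix k assume "k \<in> {..<m}"
      then have "k \<le> m - 1" "m - 1 < length xs" using m by auto
      then show "k \<in> {k. k < length xs \<and> P (xs ! k)}"
        using down[OF P, of "xs ! k"] sorted_nth_mono[OF \<open>sorted xs\<close>] by auto
    qed
    from card_mono[OF _ this] show "m \<le> length (filter P xs)"
      by (simp add: len)
  next
    assume le: "m \<le> length (filter P xs)"
    show "P (xs ! (m - 1))"
    proof (rule ccontr)
      assume nP: "\<not> P (xs ! (m - 1))"
      have "{k. k < length xs \<and> P (xs ! k)} \<subseteq> {..<m - 1}"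
        using nP down sorted_nth_mono[OF \<open>sorted xs\<close>] by (auto simp: not_less[symmetric])
      from card_mono[OF _ this] le m show False
        by (simp add: len)
    qed
  qed
qed

text \<open>The sorted list holds values, but the count runs over indices:
  \<open>[1..<Suc N]\<close> is distinct, so a tied value is counted as often as it occurs.\<close>

lemma order_stat_downward_closed_iff:
  assumes m: "1 \<le> m" "m \<le> N" and down: "\<And>x y. P y \<Longrightarrow> x \<le> y \<Longrightarrow> P x"
  shows "P (order_stat X m N \<omega>) \<longleftrightarrow> m \<le> card {k\<in>{1..N}. P (X k \<omega>)}"
proof -
  let ?f = "\<lambda>k. X k \<omega>"
  have "length (filter P (sort (map ?f [1..<Suc N]))) = card (set (filter (P \<circ> ?f) [1..<Suc N]))"
    by (subst distinct_card) (simp_all add: filter_sort filter_map del: upt_Suc)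
  also have "set (filter (P \<circ> ?f) [1..<Suc N]) = {k\<in>{1..N}. P (X k \<omega>)}"
    by (auto simp del: upt_Suc)
  finally show ?thesis
    unfolding order_stat_def
    by (subst sorted_nth_downward_closed_iff[where P = P]) (use m down in \<open>auto simp del: upt_Suc\<close>)
qed

lemma order_stat_le_iff:
  assumes "1 \<le> m" "m \<le> N"
  shows "order_stat X m N \<omega> \<le> x \<longleftrightarrow> m \<le> card {k\<in>{1..N}. X k \<omega> \<le> x}"
  using assms by (rule order_stat_downward_closed_iff) auto

lemma order_stat_less_iff:
  assumes "1 \<le> m" "m \<le> N"
  shows "order_stat X m N \<omega> < x \<longleftrightarrow> m \<le> card {k\<in>{1..N}. X k \<omega> < x}"
  using assms by (rule order_stat_downward_closed_iff) auto

lemma order_stat_in_sample: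
  assumes "1 \<le> m" "m \<le> N"
  shows "\<exists>k\<in>{1..N}. order_stat X m N \<omega> = X k \<omega>"
proof -
  have "order_stat X m N \<omega> \<in> set (sort (map (\<lambda>k. X k \<omega>) [1..<Suc N]))"
    unfolding order_stat_def by (rule nth_mem) (use assms in \<open>auto simp del: upt_Suc\<close>)
  then show ?thesis by (auto simp del: upt_Suc)
qed

lemma order_stat_eqI:
  assumes "1 \<le> m" "m \<le> N"
    and "card {k\<in>{1..N}. X k \<omega> < x} < m" "m \<le> card {k\<in>{1..N}. X k \<omega> \<le> x}"
  shows "order_stat X m N \<omega> = x"
  using assms order_stat_le_iff[of m N X \<omega> x] order_stat_less_iff[of m N X \<omega> x] by auto

lemma order_stat_mono:
  assumes "1 \<le> i" "i \<le> j" "j \<le> N"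
  shows "order_stat X i N \<omega> \<le> order_stat X j N \<omega>"
  unfolding order_stat_def
  by (rule sorted_nth_mono) (use assms in \<open>auto simp del: upt_Suc\<close>)

lemma order_stat_cong:
  assumes "\<And>k. k \<in> {1..N} \<Longrightarrow> X k \<omega> = Y k \<omega>'"
  shows "order_stat X m N \<omega> = order_stat Y m N \<omega>'"
proof -
  have "map (\<lambda>k. X k \<omega>) [1..<Suc N] = map (\<lambda>k. Y k \<omega>') [1..<Suc N]"
    by (rule map_cong) (use assms in auto)
  then show ?thesis by (simp only: order_stat_def)
qed

lemma borel_measurable_order_stat:
  assumes "1 \<le> m" "m \<le> N" and [measurable]: "\<And>k. k \<in> {1..N} \<Longrightarrow> X k \<in> borel_measurable M"
  shows "order_stat X m N \<in> borel_measurable M"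
  unfolding borel_measurable_iff_le
proof
  fix x
  have *: "{\<omega>\<in>space M. k \<in> {k\<in>{1..N}. X k \<omega> \<le> x}} \<in> sets M" for k
    by (cases "k \<in> {1..N}") (auto simp: borel_measurable_iff_le[THEN iffD1] assms(3))
  have [measurable]: "(\<lambda>\<omega>. card {k\<in>{1..N}. X k \<omega> \<le> x}) \<in> measurable M (count_space UNIV)"
    by (rule measurable_card[OF *])
  show "{\<omega>\<in>space M. order_stat X m N \<omega> \<le> x} \<in> sets M"
    unfolding order_stat_le_iff[OF assms(1,2)] by measurable
qed

subsection \<open>Binomial tails\<close>

text \<open>For \<open>1 \<le> m \<le> N\<close> and \<open>p\<close> in the unit interval this is
  also the regularized incomplete beta function with parameters \<open>m\<close> and
  \<open>N - m + 1\<close>, whence the link to the Beta law.\<close>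

definition binom_tail :: "nat \<Rightarrow> nat \<Rightarrow> real \<Rightarrow> real" where
  "binom_tail N m p = (\<Sum>k=m..N. real (N choose k) * p ^ k * (1 - p) ^ (N - k))"

lemma sum_subsets_by_card:
  fixes f :: "nat \<Rightarrow> real"
  assumes "finite R"
  shows "(\<Sum>T | T \<subseteq> R \<and> m \<le> card T. f (card T)) = (\<Sum>k=m..card R. real (card R choose k) * f k)"
proof -
  have "(\<Sum>T | T \<subseteq> R \<and> m \<le> card T. f (card T)) =
      (\<Sum>k=m..card R. \<Sum>T | T \<in> {T. T \<subseteq> R \<and> m \<le> card T} \<and> card T = k. f (card T))"
    by (rule sum.group[symmetric]) (use assms in \<open>auto simp: card_mono\<close>)
  also have "\<dots> = (\<Sum>k=m..card R. real (card R choose k) * f k)"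
  proof (rule sum.cong[OF refl])
    fix k assume "k \<in> {m..card R}"
    then have eq: "{T. T \<in> {T. T \<subseteq> R \<and> m \<le> card T} \<and> card T = k} = {T. T \<subseteq> R \<and> card T = k}"
      by auto
    have "(\<Sum>T | T \<in> {T. T \<subseteq> R \<and> m \<le> card T} \<and> card T = k. f (card T)) =
        (\<Sum>T | T \<subseteq> R \<and> card T = k. f k)"
      unfolding eq by (rule sum.cong) auto
    then show "(\<Sum>T | T \<in> {T. T \<subseteq> R \<and> m \<le> card T} \<and> card T = k. f (card T)) =
        real (card R choose k) * f k"
      by (simp add: n_subsets assms)
  qed
  finally show ?thesis .
qed

text \<open>Telescoping, by downward induction from \<open>m = N\<close>: the term
  \<open>k = m\<close> contributes the claimed derivative and a negative part that cancels the
  derivative of the tail from \<open>Suc m\<close>.\<close>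

lemma has_real_derivative_binom_tail:
  assumes "m \<le> N"
  shows "(binom_tail N m has_real_derivative
    real m * real (N choose m) * p ^ (m - 1) * (1 - p) ^ (N - m)) (at p)"
  using assms
proof (induction m rule: inc_induct)
  case base
  have "binom_tail N N = (\<lambda>p. p ^ N)"
    by (simp add: binom_tail_def fun_eq_iff)
  then show ?case by (auto intro!: derivative_eq_intros)
next
  case (step m)
  have eq: "binom_tail N m = (\<lambda>p. real (N choose m) * p ^ m * (1 - p) ^ (N - m) + binom_tail N (Suc m) p)"
    using step.hyps by (simp add: binom_tail_def fun_eq_iff sum.atLeast_Suc_atMost)
  \<comment> \<open>Both sides equal \<open>N\<close> times \<open>N - 1 choose m\<close>; this is
    what makes the two parts cancel.\<close>
  have c: "real (Suc m) * real (N choose Suc m) = real (N - m) * real (N choose m)"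
    by (metis of_nat_mult binomial_absorption binomial_absorb_comp)
  show ?case
    unfolding eq
    by (rule derivative_eq_intros step.IH refl | simp)+
      (use c in \<open>simp add: algebra_simps\<close>)
qed

lemma binom_tail_0: "1 \<le> m \<Longrightarrow> binom_tail N m 0 = 0"
  by (simp add: binom_tail_def)

text \<open>Sort the points by the set \<open>T\<close> of those coordinates in \<open>R\<close>
  that lie in \<open>A\<close>. Each \<open>T\<close> gives a box with product measure, and boxes
  for different \<open>T\<close> are disjoint because \<open>A\<close> and \<open>B\<close> are. The
  sets \<open>A\<close> and \<open>B\<close> may leave out part of the line, so the event can
  confine the coordinates in \<open>R\<close> to a half-line.\<close>

lemma measure_PiM_count:
  assumes "prob_space \<nu>" and "finite S" "finite R" "S \<inter> R = {}"
    and sets: "A \<in> sets \<nu>" "B \<in> sets \<nu>" "C \<in> sets \<nu>" and "A \<inter> B = {}"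
  shows "measure (Pi\<^sub>M (S \<union> R) (\<lambda>_. \<nu>))
      {x\<in>space (Pi\<^sub>M (S \<union> R) (\<lambda>_. \<nu>)).
        (\<forall>l\<in>S. x l \<in> C) \<and> (\<forall>l\<in>R. x l \<in> A \<union> B) \<and> m \<le> card {l\<in>R. x l \<in> A}}
    = measure \<nu> C ^ card S *
      (\<Sum>k=m..card R. real (card R choose k) * (measure \<nu> A ^ k * measure \<nu> B ^ (card R - k)))"
    (is "measure ?P ?E = _")
proof -
  interpret prob_space \<nu> by fact
  interpret P: finite_product_prob_space "\<lambda>_. \<nu>" "S \<union> R"
    by unfold_locales (use assms in auto)
  let ?side = "\<lambda>T l. if l \<in> S then C else if l \<in> T then A else B"
  let ?Ts = "{T. T \<subseteq> R \<and> m \<le> card T}"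
  have spaceD: "U \<in> sets \<nu> \<Longrightarrow> x \<in> U \<Longrightarrow> x \<in> space \<nu>" for U x
    using sets.sets_into_space by blast
  have meas: "Pi\<^sub>E (S \<union> R) (?side T) \<in> sets ?P" for T
    by (rule sets_PiM_I_finite) (use assms in auto)
  have E: "?E = (\<Union>T\<in>?Ts. Pi\<^sub>E (S \<union> R) (?side T))"
  proof (rule set_eqI, rule iffI)
    fix x assume x: "x \<in> ?E"
    then have "x \<in> Pi\<^sub>E (S \<union> R) (?side {l\<in>R. x l \<in> A})"
      by (auto simp: space_PiM PiE_iff)
    with x show "x \<in> (\<Union>T\<in>?Ts. Pi\<^sub>E (S \<union> R) (?side T))"
      by (intro UN_I[of "{l\<in>R. x l \<in> A}"]) auto
  next
    fix x assume "x \<in> (\<Union>T\<in>?Ts. Pi\<^sub>E (S \<union> R) (?side T))"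
    then obtain T where T: "T \<subseteq> R" "m \<le> card T" and x: "x \<in> Pi\<^sub>E (S \<union> R) (?side T)" by auto
    have side: "x l \<in> ?side T l" if "l \<in> S \<union> R" for l
      using x that by (rule PiE_mem)
    have S: "x l \<in> C" if "l \<in> S" for l
      using side[of l] that by simp
    have R: "if l \<in> T then x l \<in> A else x l \<in> B" if "l \<in> R" for l
    proof -
      have "l \<notin> S" using that \<open>S \<inter> R = {}\<close> by auto
      then show ?thesis using side[of l] that by auto
    qed
    then have "{l\<in>R. x l \<in> A} = T"
      using T \<open>A \<inter> B = {}\<close> by (auto split: if_splits)
    moreover have "x \<in> space ?P"
      using meas[of T] x sets.sets_into_space by blast
    ultimately show "x \<in> ?E"
      using S R T by (auto split: if_splits)
  qed
  have disj: "disjoint_family_on (\<lambda>T. Pi\<^sub>E (S \<union> R) (?side T)) ?Ts"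
    unfolding disjoint_family_on_def
  proof (intro ballI impI)
    fix T U assume TU: "T \<in> ?Ts" "U \<in> ?Ts" "T \<noteq> U"
    then obtain l where l: "l \<in> R" "l \<notin> S" "(l \<in> T) \<noteq> (l \<in> U)"
      using \<open>S \<inter> R = {}\<close> by blast
    have "x \<notin> Pi\<^sub>E (S \<union> R) (?side U)" if "x \<in> Pi\<^sub>E (S \<union> R) (?side T)" for x
      using PiE_mem[OF that, of l] PiE_mem[of x "S \<union> R" "?side U" l] l \<open>A \<inter> B = {}\<close>
      by (auto split: if_splits)
    then show "Pi\<^sub>E (S \<union> R) (?side T) \<inter> Pi\<^sub>E (S \<union> R) (?side U) = {}" by blast
  qed
  have "measure ?P ?E = (\<Sum>T\<in>?Ts. measure ?P (Pi\<^sub>E (S \<union> R) (?side T)))"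
    unfolding E by (rule P.finite_measure_finite_Union)
      (use meas disj \<open>finite R\<close> in \<open>auto intro: finite_subset[of _ "Pow R"]\<close>)
  also have "\<dots> = (\<Sum>T\<in>?Ts. measure \<nu> C ^ card S *
      (measure \<nu> A ^ card T * measure \<nu> B ^ (card R - card T)))"
  proof (rule sum.cong[OF refl])
    fix T assume T: "T \<in> ?Ts"
    have "measure ?P (Pi\<^sub>E (S \<union> R) (?side T)) = (\<Prod>l\<in>S \<union> R. measure \<nu> (?side T l))"
      by (rule P.prob_times) (use sets in auto)
    also have "\<dots> = (\<Prod>l\<in>S. measure \<nu> (?side T l)) * (\<Prod>l\<in>R. measure \<nu> (?side T l))"
      by (rule prod.union_disjoint) (use assms in auto)
    also have "(\<Prod>l\<in>S. measure \<nu> (?side T l)) = measure \<nu> C ^ card S"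
      by simp
    also have "(\<Prod>l\<in>R. measure \<nu> (?side T l)) = (\<Prod>l\<in>R. if l \<in> T then measure \<nu> A else measure \<nu> B)"
      by (rule prod.cong) (use \<open>S \<inter> R = {}\<close> in auto)
    also have "\<dots> = measure \<nu> A ^ card T * measure \<nu> B ^ card (R - T)"
    proof -
      have "R \<inter> {l. l \<in> T} = T" "R \<inter> - {l. l \<in> T} = R - T" using T by auto
      then show ?thesis
        using \<open>finite R\<close> by (simp add: prod.If_cases)
    qed
    also have "card (R - T) = card R - card T"
      using T \<open>finite R\<close> by (auto intro: card_Diff_subset finite_subset)
    finally show "measure ?P (Pi\<^sub>E (S \<union> R) (?side T)) =
        measure \<nu> C ^ card S * (measure \<nu> A ^ card T * measure \<nu> B ^ (card R - card T))" .
  qed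
  also have "\<dots> = measure \<nu> C ^ card S *
      (\<Sum>k=m..card R. real (card R choose k) * (measure \<nu> A ^ k * measure \<nu> B ^ (card R - k)))"
    unfolding sum_distrib_left[symmetric]
    by (subst sum_subsets_by_card[OF \<open>finite R\<close>]) (rule refl)
  finally show ?thesis .
qed

subsection \<open>Independent samples from a continuous law\<close>

locale iid_sample = prob_space \<nu> for \<nu> :: "real measure" +
  fixes n :: nat
  assumes sets_law[measurable_cong, simp]: "sets \<nu> = sets borel"
begin

text \<open>The canonical model: coordinates on a product space, where Fubini and box measures apply
  directly. Independent variables on an arbitrary space are carried to it by
  \<open>distr_restrict_eq_sample\<close>.\<close>

definition sample :: "(nat \<Rightarrow> real) measure" where
  "sample = Pi\<^sub>M {1..n} (\<lambda>_. \<nu>)"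

definition ord :: "nat \<Rightarrow> (nat \<Rightarrow> real) \<Rightarrow> real" where
  "ord m = order_stat (\<lambda>k x. x k) m n"

lemma space_law[simp]: "space \<nu> = UNIV"
  using sets_eq_imp_space_eq[OF sets_law] by simp

lemma prob_space_sample: "prob_space sample"
  unfolding sample_def by (rule prob_space_PiM) (rule prob_space_axioms)

lemma space_sample: "space sample = {1..n} \<rightarrow>\<^sub>E UNIV"
  by (simp add: sample_def space_PiM)

lemma measurable_coord: "k \<in> {1..n} \<Longrightarrow> (\<lambda>x. x k) \<in> borel_measurable sample"
  unfolding sample_def
  by (subst measurable_cong_sets[OF refl sets_law[symmetric]]) (rule measurable_component_singleton)

lemma measurable_ord: "1 \<le> m \<Longrightarrow> m \<le> n \<Longrightarrow> ord m \<in> borel_measurable sample"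
  unfolding ord_def by (rule borel_measurable_order_stat) (auto intro: measurable_coord)

text \<open>This is \<open>measure_PiM_count\<close> with every coordinate in \<open>R\<close>; the
  half-lines below and above \<open>a\<close> cover the line, so only the count remains as a
  condition.\<close>

lemma measure_ord_le:
  assumes m: "1 \<le> m" "m \<le> n"
  shows "measure sample {x\<in>space sample. ord m x \<le> a} = binom_tail n m (measure \<nu> {..a})"
proof -
  have comp: "measure \<nu> {a<..} = 1 - measure \<nu> {..a}"
    using prob_compl[of "{..a}"] by (simp add: Compl_eq_Diff_UNIV[symmetric])
  have disj: "{..a} \<inter> {a<..} = {}" by auto
  have "{x\<in>space sample. ord m x \<le> a} = {x\<in>space (Pi\<^sub>M ({} \<union> {1..n}) (\<lambda>_. \<nu>)).
      (\<forall>l\<in>{}. x l \<in> {}) \<and> (\<forall>l\<in>{1..n}. x l \<in> {..a} \<union> {a<..}) \<and> m \<le> card {l\<in>{1..n}. x l \<in> {..a}}}"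
    unfolding sample_def ord_def order_stat_le_iff[OF m] by auto
  then have "measure sample {x\<in>space sample. ord m x \<le> a} =
    measure \<nu> {} ^ card ({}::nat set) * (\<Sum>k=m..card {1..n}. real (card {1..n} choose k) *
      (measure \<nu> {..a} ^ k * measure \<nu> {a<..} ^ (card {1..n} - k)))"
    unfolding sample_def
    using measure_PiM_count[OF prob_space_axioms finite.emptyI finite_atLeastAtMost Int_empty_left,
        of "{..a}" "{a<..}" "{}" 1 n m] disj
    by simp
  then show ?thesis
    by (simp add: binom_tail_def comp mult.assoc)
qed

text \<open>Fubini with coordinate \<open>k\<close> outermost. It replaces conditioning on the value
  \<open>t\<close> of that coordinate.\<close>

lemma emeasure_sample_pivot:
  assumes k: "k \<in> {1..n}" and D: "D \<in> sets sample"
  shows "emeasure sample D =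
    (\<integral>\<^sup>+t. emeasure (Pi\<^sub>M ({1..n} - {k}) (\<lambda>_. \<nu>))
        {x\<in>space (Pi\<^sub>M ({1..n} - {k}) (\<lambda>_. \<nu>)). x(k := t) \<in> D} \<partial>\<nu>)"
proof -
  let ?J = "{1..n} - {k}"
  interpret product_sigma_finite "\<lambda>_. \<nu>"
    by unfold_locales
  have ins: "insert k ?J = {1..n}" using k by auto
  have D': "D \<in> sets (Pi\<^sub>M (insert k ?J) (\<lambda>_. \<nu>))"
    using D unfolding sample_def ins .
  have "emeasure sample D = (\<integral>\<^sup>+x. indicator D x \<partial>Pi\<^sub>M (insert k ?J) (\<lambda>_. \<nu>))"
    using D' unfolding sample_def ins by simp
  also have "\<dots> = (\<integral>\<^sup>+t. (\<integral>\<^sup>+x. indicator D (x(k := t)) \<partial>Pi\<^sub>M ?J (\<lambda>_. \<nu>)) \<partial>\<nu>)"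
    by (rule product_nn_integral_insert_rev) (use D' in auto)
  also have "\<dots> = (\<integral>\<^sup>+t. emeasure (Pi\<^sub>M ?J (\<lambda>_. \<nu>)) {x\<in>space (Pi\<^sub>M ?J (\<lambda>_. \<nu>)). x(k := t) \<in> D} \<partial>\<nu>)"
  proof (rule nn_integral_cong)
    fix t
    have "(\<lambda>x. x(k := t)) \<in> measurable (Pi\<^sub>M ?J (\<lambda>_. \<nu>)) (Pi\<^sub>M (insert k ?J) (\<lambda>_. \<nu>))"
      by (rule measurable_fun_upd[where J = ?J]) auto
    from measurable_sets[OF this D']
    have meas: "{x\<in>space (Pi\<^sub>M ?J (\<lambda>_. \<nu>)). x(k := t) \<in> D} \<in> sets (Pi\<^sub>M ?J (\<lambda>_. \<nu>))"
      by (simp add: vimage_def Int_def conj_commute)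
    have "(\<integral>\<^sup>+x. indicator D (x(k := t)) \<partial>Pi\<^sub>M ?J (\<lambda>_. \<nu>)) =
        (\<integral>\<^sup>+x. indicator {x\<in>space (Pi\<^sub>M ?J (\<lambda>_. \<nu>)). x(k := t) \<in> D} x \<partial>Pi\<^sub>M ?J (\<lambda>_. \<nu>))"
      by (rule nn_integral_cong) (simp add: indicator_def)
    then show "(\<integral>\<^sup>+x. indicator D (x(k := t)) \<partial>Pi\<^sub>M ?J (\<lambda>_. \<nu>)) =
        emeasure (Pi\<^sub>M ?J (\<lambda>_. \<nu>)) {x\<in>space (Pi\<^sub>M ?J (\<lambda>_. \<nu>)). x(k := t) \<in> D}"
      using nn_integral_indicator[OF meas] by simp
  qed
  finally show ?thesis .
qed

end

section \<open>Absence of ties and decomposition by the observation of rank \<open>i\<close>\<close>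

locale continuous_iid_sample = iid_sample +
  assumes atomless: "emeasure \<nu> {t} = 0"
begin

text \<open>With \<open>x k = t\<close> fixed, a tie is a box with side \<open>{t}\<close> at
  \<open>l\<close>, which is null for an atomless law.\<close>

lemma AE_sample_distinct:
  assumes kl: "k \<in> {1..n}" "l \<in> {1..n}" "k \<noteq> l"
  shows "AE x in sample. x k \<noteq> x l"
proof (rule AE_I)
  let ?J = "{1..n} - {k}"
  interpret product_sigma_finite "\<lambda>_. \<nu>"
    by unfold_locales
  note [measurable] = measurable_coord[OF kl(1)] measurable_coord[OF kl(2)]
  show D: "{x\<in>space sample. x k = x l} \<in> sets sample" by measurable
  show "{x\<in>space sample. \<not> x k \<noteq> x l} \<subseteq> {x\<in>space sample. x k = x l}" by auto
  have "emeasure sample {x\<in>space sample. x k = x l} = (\<integral>\<^sup>+t. 0 \<partial>\<nu>)"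
    unfolding emeasure_sample_pivot[OF kl(1) D]
  proof (rule nn_integral_cong)
    fix t
    have "{x\<in>space (Pi\<^sub>M ?J (\<lambda>_. \<nu>)). x(k := t) \<in> {x\<in>space sample. x k = x l}} =
        Pi\<^sub>E ?J (\<lambda>m. if m = l then {t} else UNIV)"
    proof (rule set_eqI)
      fix x :: "nat \<Rightarrow> real"
      have "x(k := t) \<in> space sample" if "x \<in> extensional ?J"
        using that kl(1) by (auto simp: space_sample PiE_iff extensional_def)
      moreover have "x \<in> space (Pi\<^sub>M ?J (\<lambda>_. \<nu>)) \<longleftrightarrow> x \<in> extensional ?J"
        by (simp add: space_PiM PiE_iff)
      moreover have "x \<in> Pi\<^sub>E ?J (\<lambda>m. if m = l then {t} else UNIV) \<longleftrightarrow> x \<in> extensional ?J \<and> x l = t"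
        using kl by (auto simp: PiE_iff)
      ultimately show "x \<in> {x\<in>space (Pi\<^sub>M ?J (\<lambda>_. \<nu>)). x(k := t) \<in> {x\<in>space sample. x k = x l}} \<longleftrightarrow>
          x \<in> Pi\<^sub>E ?J (\<lambda>m. if m = l then {t} else UNIV)"
        using kl(3) by (simp only: mem_Collect_eq fun_upd_apply) auto
    qed
    moreover have "emeasure (Pi\<^sub>M ?J (\<lambda>_. \<nu>)) (Pi\<^sub>E ?J (\<lambda>m. if m = l then {t} else UNIV)) =
        (\<Prod>m\<in>?J. emeasure \<nu> (if m = l then {t} else UNIV))"
      by (rule emeasure_PiM) auto
    moreover have "\<dots> = 0"
      by (rule prod_zero) (use kl atomless in auto)
    ultimately show "emeasure (Pi\<^sub>M ?J (\<lambda>_. \<nu>))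
        {x\<in>space (Pi\<^sub>M ?J (\<lambda>_. \<nu>)). x(k := t) \<in> {x\<in>space sample. x k = x l}} = 0"
      by simp
  qed
  then show "emeasure sample {x\<in>space sample. x k = x l} = 0" by simp
qed

text \<open>The inequalities are strict on both sides, so no other coordinate shares the value
  \<open>x k\<close>; ties among the other coordinates remain possible.\<close>

definition pivot_event :: "nat \<Rightarrow> nat set \<Rightarrow> (nat \<Rightarrow> real) set" where
  "pivot_event k S = {x\<in>space sample. (\<forall>l\<in>S. x l < x k) \<and> (\<forall>l\<in>{1..n} - {k} - S. x k < x l)}"

definition pivots :: "nat \<Rightarrow> (nat \<times> nat set) set" where
  "pivots i = {(k, S). k \<in> {1..n} \<and> S \<subseteq> {1..n} - {k} \<and> card S = i - 1}"

lemma finite_pivots: "finite (pivots i)"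
  by (rule finite_subset[of _ "{1..n} \<times> Pow {1..n}"]) (auto simp: pivots_def)

lemma pivot_event_sets:
  assumes "k \<in> {1..n}" "S \<subseteq> {1..n}"
  shows "pivot_event k S \<in> sets sample"
proof -
  have [measurable]: "(\<lambda>x. x l) \<in> borel_measurable sample" if "l \<in> {1..n}" for l
    using that by (rule measurable_coord)
  have "{x\<in>space sample. x l < x m} \<in> sets sample" if "l \<in> {1..n}" "m \<in> {1..n}" for l m
    using that by measurable
  then show ?thesis
    unfolding pivot_event_def
    by (intro sets.sets_Collect_conj sets.sets_Collect_finite_All)
      (use assms in \<open>auto intro: finite_subset\<close>)
qed

lemma pivot_event_less_iff:
  assumes "(k, S) \<in> pivots i" and "x \<in> pivot_event k S" and "l \<in> {1..n}"
  shows "x l < x k \<longleftrightarrow> l \<in> S"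
proof (cases "l \<in> S \<or> l = k")
  case False
  then have "x k < x l" using assms by (auto simp: pivot_event_def)
  then show ?thesis using False by auto
qed (use assms in \<open>auto simp: pivot_event_def pivots_def\<close>)

lemma pivot_event_le_iff:
  assumes "(k, S) \<in> pivots i" and "x \<in> pivot_event k S" and "l \<in> {1..n}"
  shows "x l \<le> x k \<longleftrightarrow> l \<in> insert k S"
proof (cases "l \<in> S \<or> l = k")
  case False
  then have "x k < x l" using assms by (auto simp: pivot_event_def)
  then show ?thesis using False by auto
qed (use assms in \<open>auto simp: pivot_event_def\<close>)

lemma ord_pivot_event:
  assumes "(k, S) \<in> pivots i" "1 \<le> i" "i \<le> n" and x: "x \<in> pivot_event k S"
  shows "ord i x = x k"
proof -
  have k: "k \<in> {1..n}" and S: "S \<subseteq> {1..n} - {k}" "card S = i - 1"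
    using assms by (auto simp: pivots_def)
  then have "finite S" by (auto intro: finite_subset)
  have "{l\<in>{1..n}. x l < x k} = S" "{l\<in>{1..n}. x l \<le> x k} = insert k S"
    using k S pivot_event_less_iff[OF assms(1) x] pivot_event_le_iff[OF assms(1) x] by auto
  moreover have "card (insert k S) = i"
    using k S \<open>finite S\<close> \<open>1 \<le> i\<close> by (subst card_insert_disjoint) auto
  ultimately show ?thesis
    unfolding ord_def using S assms by (intro order_stat_eqI) auto
qed

text \<open>Both pivots carry the value \<open>ord i x\<close>. Hence \<open>k'\<close> lies in
  \<open>insert k S\<close> by the weak comparison and outside \<open>S\<close> by the strict one,
  so \<open>k' = k\<close>; then \<open>S\<close> and \<open>S'\<close> are the same set of smaller
  coordinates.\<close>

lemma pivot_event_unique: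
  assumes "(k, S) \<in> pivots i" "(k', S') \<in> pivots i" "1 \<le> i" "i \<le> n"
    and x: "x \<in> pivot_event k S" "x \<in> pivot_event k' S'"
  shows "k = k' \<and> S = S'"
proof -
  have eq: "x k = x k'"
    using ord_pivot_event[OF assms(1) assms(3,4) x(1)] ord_pivot_event[OF assms(2) assms(3,4) x(2)] by simp
  have "S = {l\<in>{1..n}. x l < x k}" "S' = {l\<in>{1..n}. x l < x k'}"
    using pivot_event_less_iff[OF assms(1) x(1)] pivot_event_less_iff[OF assms(2) x(2)]
      assms(1,2) unfolding pivots_def by auto
  moreover have "k = k'"
  proof (rule ccontr)
    assume "k \<noteq> k'"
    then show False
      using pivot_event_le_iff[OF assms(1) x(1), of k'] pivot_event_less_iff[OF assms(1) x(1), of k']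
        assms(2) eq by (auto simp: pivots_def)
  qed
  ultimately show ?thesis by simp
qed

text \<open>Take \<open>k\<close> attaining the \<open>i\<close>-th order statistic. Without ties
  exactly one more coordinate is at most \<open>x k\<close> than is below it, and the two rank
  inequalities then force \<open>i - 1\<close> coordinates below.\<close>

lemma AE_pivot_event:
  assumes i: "1 \<le> i" "i \<le> n"
  shows "AE x in sample. \<exists>(k, S)\<in>pivots i. x \<in> pivot_event k S"
proof -
  have "AE x in sample. \<forall>k\<in>{1..n}. \<forall>l\<in>{1..n}. k \<noteq> l \<longrightarrow> x k \<noteq> x l"
    using AE_sample_distinct by (auto intro!: AE_finite_allI)
  moreover have "AE x in sample. x \<in> space sample" by (rule AE_space)
  ultimately show ?thesis
  proof eventually_elim
    case (elim x)
    obtain k where k: "k \<in> {1..n}" "ord i x = x k"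
      using order_stat_in_sample[OF i, of "\<lambda>k x. x k" x] unfolding ord_def by metis
    let ?S = "{l\<in>{1..n}. x l < x k}"
    have less: "card ?S < i"
      using order_stat_less_iff[OF i, of "\<lambda>k x. x k" x "x k"] k by (simp add: ord_def)
    have "i \<le> card {l\<in>{1..n}. x l \<le> x k}"
      using order_stat_le_iff[OF i, of "\<lambda>k x. x k" x "x k"] k by (simp add: ord_def)
    also have "{l\<in>{1..n}. x l \<le> x k} = insert k ?S"
      using elim(1) k by (auto simp: le_less)
    also have "card (insert k ?S) = Suc (card ?S)"
      by (subst card_insert_disjoint) auto
    finally have "card ?S = i - 1" using less by simp
    then have "(k, ?S) \<in> pivots i"
      using k by (auto simp: pivots_def)
    moreover have "x \<in> pivot_event k ?S"
      using elim k by (auto simp: pivot_event_def not_less le_less)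
    ultimately show ?case by blast
  qed
qed

lemma emeasure_sum_pivots:
  assumes i: "1 \<le> i" "i \<le> n" and D: "D \<in> sets sample"
  shows "emeasure sample D = (\<Sum>(k, S)\<in>pivots i. emeasure sample (pivot_event k S \<inter> D))"
proof -
  have meas: "pivot_event k S \<inter> D \<in> sets sample" if "(k, S) \<in> pivots i" for k S
    using that D by (intro sets.Int pivot_event_sets) (auto simp: pivots_def)
  have "emeasure sample D = emeasure sample (\<Union>(k, S)\<in>pivots i. pivot_event k S \<inter> D)"
  proof (rule emeasure_eq_AE)
    show "AE x in sample. x \<in> D \<longleftrightarrow> x \<in> (\<Union>(k, S)\<in>pivots i. pivot_event k S \<inter> D)"
      using AE_pivot_event[OF i] by eventually_elim auto
    show "(\<Union>(k, S)\<in>pivots i. pivot_event k S \<inter> D) \<in> sets sample"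
      using meas finite_pivots by (intro sets.finite_UN) auto
  qed (rule D)
  also have "\<dots> = (\<Sum>p\<in>pivots i. emeasure sample (case p of (k, S) \<Rightarrow> pivot_event k S \<inter> D))"
  proof (rule sum_emeasure[symmetric])
    show "disjoint_family_on (\<lambda>(k, S). pivot_event k S \<inter> D) (pivots i)"
      unfolding disjoint_family_on_def
    proof (intro ballI impI)
      fix p q assume "p \<in> pivots i" "q \<in> pivots i" "p \<noteq> q"
      then show "(case p of (k, S) \<Rightarrow> pivot_event k S \<inter> D) \<inter> (case q of (k, S) \<Rightarrow> pivot_event k S \<inter> D) = {}"
        using pivot_event_unique[OF _ _ i] by (cases p, cases q) blast
    qed
  qed (use meas finite_pivots in auto)
  finally show ?thesis by (simp add: case_prod_unfold)
qed

text \<open>The common probability of all pivot events for the given \<open>i\<close>: the other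
  coordinates fall on their prescribed sides of \<open>t\<close>, and \<open>t\<close> is averaged
  over the law. By exchangeability neither \<open>k\<close> nor \<open>S\<close> occurs.\<close>

definition pivot_weight :: "nat \<Rightarrow> ennreal" where
  "pivot_weight i = (\<integral>\<^sup>+t. ennreal (measure \<nu> {..<t} ^ (i - 1) * measure \<nu> {t<..} ^ (n - i)) \<partial>\<nu>)"

text \<open>Fix \<open>x k = t\<close>. Then \<open>k\<close> and \<open>S\<close> already supply
  \<open>i\<close> coordinates at most \<open>h t\<close>, so \<open>j - i\<close> more are needed
  among the \<open>n - i\<close> coordinates above \<open>t\<close>. The mass above \<open>t\<close>
  is split by \<open>h t\<close> in the ratio \<open>p\<close> to \<open>1 - p\<close>, so the slice
  is the integrand of \<open>pivot_weight\<close> times a binomial tail free of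
  \<open>t\<close>.\<close>

lemma emeasure_pivot_event_le:
  assumes i: "1 \<le> i" "i \<le> j" "j \<le> n" and p: "0 \<le> p" "p \<le> 1"
    and [measurable]: "h \<in> borel_measurable borel"
    and h: "AE t in \<nu>. t \<le> h t \<and> measure \<nu> {h t<..} = (1 - p) * measure \<nu> {t<..}"
    and kS: "(k, S) \<in> pivots i"
  shows "emeasure sample (pivot_event k S \<inter> {x\<in>space sample. ord j x \<le> h (ord i x)}) =
    pivot_weight i * ennreal (binom_tail (n - i) (j - i) p)"
proof -
  let ?J = "{1..n} - {k}"
  let ?R = "?J - S"
  let ?PJ = "Pi\<^sub>M ?J (\<lambda>_. \<nu>)"
  let ?E = "pivot_event k S \<inter> {x\<in>space sample. ord j x \<le> h (ord i x)}"
  interpret J: prob_space ?PJ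
    by (rule prob_space_PiM) (rule prob_space_axioms)
  have k: "k \<in> {1..n}" and S: "S \<subseteq> ?J" "card S = i - 1"
    using kS by (auto simp: pivots_def)
  have "finite S" using S by (auto intro: finite_subset)
  have cardR: "card ?R = n - i"
    using S k i \<open>finite S\<close> by (simp add: card_Diff_subset)
  have SR: "S \<union> ?R = ?J" using S by auto
  have [measurable]: "ord i \<in> borel_measurable sample" "ord j \<in> borel_measurable sample"
    using i by (auto intro: measurable_ord)
  have "{x\<in>space sample. ord j x \<le> h (ord i x)} \<in> sets sample" by measurable
  then have E: "?E \<in> sets sample"
    using k S by (intro sets.Int pivot_event_sets) auto
  have slice: "emeasure ?PJ {x\<in>space ?PJ. x(k := t) \<in> ?E} =
      ennreal (measure \<nu> {..<t} ^ (i - 1) * measure \<nu> {t<..} ^ (n - i)) *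
      ennreal (binom_tail (n - i) (j - i) p)"
    if t: "t \<le> h t" "measure \<nu> {h t<..} = (1 - p) * measure \<nu> {t<..}" for t
  proof -
    have AB: "{t<..h t} \<inter> {h t<..} = {}" by auto
    have "{t<..h t} = {t<..} - {h t<..}" by auto
    then have A: "measure \<nu> {t<..h t} = p * measure \<nu> {t<..}"
      using t by (simp add: finite_measure_Diff algebra_simps)
    have slice_iff: "x(k := t) \<in> ?E \<longleftrightarrow> (\<forall>l\<in>S. x l \<in> {..<t}) \<and> (\<forall>l\<in>?R. x l \<in> {t<..h t} \<union> {h t<..}) \<and>
        j - i \<le> card {l\<in>?R. x l \<in> {t<..h t}}" if x: "x \<in> space ?PJ" for x
    proof -
      let ?x = "x(k := t)"
      have sp: "?x \<in> space sample"
        using x k by (auto simp: space_PiM space_sample PiE_iff extensional_def)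
      have ev: "?x \<in> pivot_event k S \<longleftrightarrow> (\<forall>l\<in>S. x l < t) \<and> (\<forall>l\<in>?R. t < x l)"
        using sp S by (auto simp: pivot_event_def)
      have cnt: "ord j ?x \<le> h (ord i ?x) \<longleftrightarrow> j - i \<le> card {l\<in>?R. t < x l \<and> x l \<le> h t}"
        if e: "?x \<in> pivot_event k S"
      proof -
        have "ord i ?x = t"
          using ord_pivot_event[OF kS _ _ e] i by simp
        then have "ord j ?x \<le> h (ord i ?x) \<longleftrightarrow> j \<le> card {l\<in>{1..n}. ?x l \<le> h t}"
          using i by (simp add: ord_def order_stat_le_iff)
        also have "{l\<in>{1..n}. ?x l \<le> h t} = insert k S \<union> {l\<in>?R. t < x l \<and> x l \<le> h t}"
          using e[unfolded ev] k S t(1) by fastforce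
        also have "card \<dots> = card (insert k S) + card {l\<in>?R. t < x l \<and> x l \<le> h t}"
          using \<open>finite S\<close> by (intro card_Un_disjoint) auto
        also have "card (insert k S) = i"
          using k S \<open>finite S\<close> i by (subst card_insert_disjoint) auto
        finally show ?thesis by (simp only: le_diff_conv add.commute)
      qed
      have right: "y \<in> {t<..h t} \<union> {h t<..} \<longleftrightarrow> t < y" for y
        using t(1) by auto
      have "?x \<in> ?E \<longleftrightarrow> ?x \<in> pivot_event k S \<and> ord j ?x \<le> h (ord i ?x)"
        using sp by (simp only: Int_iff mem_Collect_eq simp_thms)
      also have "\<dots> \<longleftrightarrow> ?x \<in> pivot_event k S \<and> j - i \<le> card {l\<in>?R. t < x l \<and> x l \<le> h t}"
        by (rule conj_cong[OF refl cnt])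
      finally show ?thesis
        unfolding ev right by (simp only: lessThan_iff greaterThanAtMost_iff conj_assoc)
    qed
    have "{x\<in>space ?PJ. x(k := t) \<in> ?E} =
        {x\<in>space ?PJ. (\<forall>l\<in>S. x l \<in> {..<t}) \<and> (\<forall>l\<in>?R. x l \<in> {t<..h t} \<union> {h t<..}) \<and>
          j - i \<le> card {l\<in>?R. x l \<in> {t<..h t}}}"
      by (intro Collect_cong conj_cong refl slice_iff)
    moreover have "measure ?PJ {x\<in>space ?PJ. (\<forall>l\<in>S. x l \<in> {..<t}) \<and>
          (\<forall>l\<in>?R. x l \<in> {t<..h t} \<union> {h t<..}) \<and> j - i \<le> card {l\<in>?R. x l \<in> {t<..h t}}} =
        measure \<nu> {..<t} ^ card S * (\<Sum>l=j - i..card ?R. real (card ?R choose l) *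
          (measure \<nu> {t<..h t} ^ l * measure \<nu> {h t<..} ^ (card ?R - l)))"
      using measure_PiM_count[OF prob_space_axioms \<open>finite S\<close>, of ?R "{t<..h t}" "{h t<..}" "{..<t}" "j - i"]
      unfolding SR using AB by auto
    moreover have "\<dots> = measure \<nu> {..<t} ^ (i - 1) * measure \<nu> {t<..} ^ (n - i) *
        binom_tail (n - i) (j - i) p"
    proof -
      \<comment> \<open>Each summand is homogeneous of degree \<open>n - i\<close> in the mass
        \<open>g\<close> above \<open>t\<close>, so this power factors out and \<open>t\<close>
        disappears from the sum.\<close>
      have "real (n - i choose l) * ((p * g) ^ l * ((1 - p) * g) ^ (n - i - l)) =
          g ^ (n - i) * (real (n - i choose l) * p ^ l * (1 - p) ^ (n - i - l))"
        if "l \<in> {j - i..n - i}" for l g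
      proof -
        have "l \<le> n - i" using that by simp
        then obtain r where "n - i = l + r" using le_Suc_ex by blast
        then show ?thesis by (simp add: power_mult_distrib power_add)
      qed
      then have "(\<Sum>l=j - i..n - i. real (n - i choose l) *
          ((p * measure \<nu> {t<..}) ^ l * ((1 - p) * measure \<nu> {t<..}) ^ (n - i - l))) =
        measure \<nu> {t<..} ^ (n - i) * binom_tail (n - i) (j - i) p"
        unfolding binom_tail_def sum_distrib_left by (intro sum.cong) auto
      then show ?thesis unfolding cardR S(2) A t(2) by simp
    qed
    ultimately have "measure ?PJ {x\<in>space ?PJ. x(k := t) \<in> ?E} =
        measure \<nu> {..<t} ^ (i - 1) * measure \<nu> {t<..} ^ (n - i) * binom_tail (n - i) (j - i) p"
      by (simp only:)
    then show ?thesis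
      unfolding J.emeasure_eq_measure by (simp only: ennreal_mult' measure_nonneg zero_le_power mult_nonneg_nonneg)
  qed
  have "emeasure sample ?E = (\<integral>\<^sup>+t. ennreal (measure \<nu> {..<t} ^ (i - 1) * measure \<nu> {t<..} ^ (n - i)) *
      ennreal (binom_tail (n - i) (j - i) p) \<partial>\<nu>)"
    unfolding emeasure_sample_pivot[OF k E]
  proof (rule nn_integral_cong_AE)
    show "AE t in \<nu>. emeasure ?PJ {x\<in>space ?PJ. x(k := t) \<in> ?E} =
        ennreal (measure \<nu> {..<t} ^ (i - 1) * measure \<nu> {t<..} ^ (n - i)) *
        ennreal (binom_tail (n - i) (j - i) p)"
      using h by eventually_elim (rule slice; simp)
  qed
  also have "\<dots> = pivot_weight i * ennreal (binom_tail (n - i) (j - i) p)"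
    unfolding pivot_weight_def
  proof (rule nn_integral_multc)
    have "mono (\<lambda>t. measure \<nu> {..<t})" "antimono (\<lambda>t. measure \<nu> {t<..})"
      by (auto simp: mono_def antimono_def intro!: finite_measure_mono)
    then have [measurable]: "(\<lambda>t. measure \<nu> {..<t}) \<in> borel_measurable borel"
        "(\<lambda>t. measure \<nu> {t<..}) \<in> borel_measurable borel"
      using borel_measurable_mono[of "\<lambda>t. - measure \<nu> {t<..}"]
      by (auto intro: borel_measurable_mono simp: mono_def antimono_def)
    show "(\<lambda>t. ennreal (measure \<nu> {..<t} ^ (i - 1) * measure \<nu> {t<..} ^ (n - i))) \<in> borel_measurable \<nu>"
      by measurable
  qed
  finally show ?thesis .
qed

text \<open>For an exponential law, \<open>h t = t + x\<close>; for a Pareto law, \<open>h t = e\<^sup>x t\<close>.\<close>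

lemma measure_ord_le_ord:
  assumes i: "1 \<le> i" "i \<le> j" "j \<le> n" and p: "0 \<le> p" "p \<le> 1"
    and h[measurable]: "h \<in> borel_measurable borel"
    and "AE t in \<nu>. t \<le> h t \<and> measure \<nu> {h t<..} = (1 - p) * measure \<nu> {t<..}"
  shows "measure sample {x\<in>space sample. ord j x \<le> h (ord i x)} = binom_tail (n - i) (j - i) p"
proof -
  interpret sample: prob_space sample by (rule prob_space_sample)
  \<comment> \<open>Generalised over \<open>j\<close>, \<open>p\<close> and \<open>h\<close>, so
    that it serves both the given data and the normalisation.\<close>
  have sum: "emeasure sample {x\<in>space sample. ord j x \<le> h (ord i x)} =
      of_nat (card (pivots i)) * pivot_weight i * ennreal (binom_tail (n - i) (j - i) p)"
    if i: "1 \<le> i" "i \<le> j" "j \<le> n" and p: "0 \<le> p" "p \<le> 1"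
      and h[measurable]: "h \<in> borel_measurable borel"
      and AE: "AE t in \<nu>. t \<le> h t \<and> measure \<nu> {h t<..} = (1 - p) * measure \<nu> {t<..}" for j p h
  proof -
    have [measurable]: "ord i \<in> borel_measurable sample" "ord j \<in> borel_measurable sample"
      using i by (auto intro: measurable_ord)
    have "{x\<in>space sample. ord j x \<le> h (ord i x)} \<in> sets sample" by measurable
    then have "emeasure sample {x\<in>space sample. ord j x \<le> h (ord i x)} =
        (\<Sum>(k, S)\<in>pivots i. emeasure sample (pivot_event k S \<inter> {x\<in>space sample. ord j x \<le> h (ord i x)}))"
      using i by (intro emeasure_sum_pivots) auto
    also have "\<dots> = (\<Sum>(k, S)\<in>pivots i. pivot_weight i * ennreal (binom_tail (n - i) (j - i) p))"
      by (intro sum.cong refl) (auto simp: emeasure_pivot_event_le[OF i p h AE])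
    finally show ?thesis by (simp add: case_prod_unfold mult.assoc)
  qed
  \<comment> \<open>The total weight of the pivots is read off the trivial case \<open>j = i\<close>, \<open>h = id\<close>.\<close>
  have "binom_tail (n - i) 0 0 = 1"
    by (simp add: binom_tail_def sum.atLeast_Suc_atMost)
  then have "of_nat (card (pivots i)) * pivot_weight i = 1"
    using sum[of i 0 "\<lambda>t. t"] i sample.emeasure_space_1 by auto
  then have "emeasure sample {x\<in>space sample. ord j x \<le> h (ord i x)} =
      ennreal (binom_tail (n - i) (j - i) p)"
    using sum[of j p h] assms by simp
  moreover have "0 \<le> binom_tail (n - i) (j - i) p"
    using p by (auto simp: binom_tail_def intro!: sum_nonneg)
  ultimately show ?thesis
    by (simp add: measure_def)
qed

end

subsection \<open>The density of the logarithmic ratio and its moments\<close>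

text \<open>The derivative in \<open>x\<close> of
  \<open>binom_tail N m (1 - exp (- \<alpha> * x))\<close>; the chain rule supplies
  \<open>\<alpha>\<close> and the extra exponential factor. The constant stays in the form
  \<open>m * (N choose m)\<close>, which suits the absorption identity and makes the function vanish
  for \<open>m = 0\<close>.\<close>

definition spacing_density :: "real \<Rightarrow> nat \<Rightarrow> nat \<Rightarrow> real \<Rightarrow> real" where
  "spacing_density \<alpha> N m x = (if 0 < x
     then \<alpha> * (real m * real (N choose m)) * (1 - exp (- \<alpha> * x)) ^ (m - 1) * exp (- \<alpha> * x) ^ (N - m + 1)
     else 0)"

lemma borel_measurable_spacing_density[measurable]: "spacing_density \<alpha> N m \<in> borel_measurable borel"
  unfolding spacing_density_def[abs_def] by measurable

lemma spacing_density_nonneg: "0 < \<alpha> \<Longrightarrow> 0 \<le> spacing_density \<alpha> N m x"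
  by (auto simp: spacing_density_def intro!: mult_nonneg_nonneg zero_le_power)

lemma real_mult_binomial_eq_fact:
  assumes "1 \<le> m" "m \<le> N"
  shows "real m * real (N choose m) = fact N / (fact (m - 1) * fact (N - m))"
  using assms fact_reduce[of m, where 'a = real] by (simp add: binomial_fact divide_simps)

lemma nn_integral_spacing_density:
  assumes \<alpha>: "0 < \<alpha>" and m: "1 \<le> m" "m \<le> N" and a: "0 \<le> a"
  shows "(\<integral>\<^sup>+x. ennreal (spacing_density \<alpha> N m x) * indicator {..a} x \<partial>lborel) =
    ennreal (binom_tail N m (1 - exp (- \<alpha> * a)))"
proof -
  let ?f = "\<lambda>x. \<alpha> * (real m * real (N choose m)) * (1 - exp (- \<alpha> * x)) ^ (m - 1) * exp (- \<alpha> * x) ^ (N - m + 1)"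
  have "(\<integral>\<^sup>+x. ennreal (spacing_density \<alpha> N m x) * indicator {..a} x \<partial>lborel) =
      (\<integral>\<^sup>+x. ennreal (?f x) * indicator {0..a} x \<partial>lborel)"
    \<comment> \<open>The point 0 is removed: the density is 0 there, whereas \<open>?f\<close> is
      positive at 0 when \<open>m = 1\<close>.\<close>
    by (rule nn_integral_cong_AE, rule AE_mp[OF AE_lborel_singleton[of "0::real"]])
      (auto simp: spacing_density_def split: split_indicator)
  also have "\<dots> = binom_tail N m (1 - exp (- \<alpha> * a)) - binom_tail N m (1 - exp (- \<alpha> * 0))"
  proof (rule nn_integral_FTC_Icc)
    show "?f \<in> borel_measurable borel" by measurable
    fix x :: real
    have "((\<lambda>x. binom_tail N m (1 - exp (- \<alpha> * x))) has_real_derivative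
        (real m * real (N choose m) * (1 - exp (- \<alpha> * x)) ^ (m - 1) *
          (1 - (1 - exp (- \<alpha> * x))) ^ (N - m)) * (\<alpha> * exp (- \<alpha> * x))) (at x)"
      by (rule DERIV_chain2[OF has_real_derivative_binom_tail[OF m(2)]])
        (auto intro!: derivative_eq_intros)
    then show "((\<lambda>x. binom_tail N m (1 - exp (- \<alpha> * x))) has_real_derivative ?f x) (at x)"
      by (simp add: mult_ac)
    show "0 \<le> ?f x" if "x \<in> {0..a}"
      using \<alpha> that by (auto intro!: mult_nonneg_nonneg zero_le_power)
  qed (rule a)
  finally show ?thesis using m by (simp add: binom_tail_0)
qed

text \<open>The criterion through which every law in the theorem passes. The half-line
  \<open>0 \<le> x\<close> suffices: at 0 the tail vanishes, so by monotonicity there is no mass on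
  the negative side.\<close>

lemma (in prob_space) distributed_spacing_densityI:
  assumes \<alpha>: "0 < \<alpha>" and m: "1 \<le> m" "m \<le> N" and W[measurable]: "W \<in> borel_measurable M"
    and cdf: "\<And>x. 0 \<le> x \<Longrightarrow> prob {\<omega>\<in>space M. W \<omega> \<le> x} = binom_tail N m (1 - exp (- \<alpha> * x))"
  shows "distributed M lborel W (spacing_density \<alpha> N m)"
proof -
  let ?g = "\<lambda>a. if a < 0 then 0 else binom_tail N m (1 - exp (- \<alpha> * a))"
  have g_eq: "(\<integral>\<^sup>+x. ennreal (spacing_density \<alpha> N m x) * indicator {..a} x \<partial>lborel) = ennreal (?g a)" for a
  proof (cases "a < 0")
    case True
    then have "(\<integral>\<^sup>+x. ennreal (spacing_density \<alpha> N m x) * indicator {..a} x \<partial>lborel) = (\<integral>\<^sup>+x. 0 \<partial>(lborel :: real measure))"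
      by (intro nn_integral_cong) (auto simp: spacing_density_def split: split_indicator)
    with True show ?thesis by simp
  qed (use nn_integral_spacing_density[OF \<alpha> m] in simp)
  have M_eq: "emeasure M {\<omega>\<in>space M. W \<omega> \<le> a} = ennreal (?g a)" for a
  proof (cases "a < 0")
    case True
    then have "prob {\<omega>\<in>space M. W \<omega> \<le> a} \<le> prob {\<omega>\<in>space M. W \<omega> \<le> 0}"
      by (intro finite_measure_mono) auto
    also have "\<dots> = 0" using cdf[of 0] m by (simp add: binom_tail_0)
    finally show ?thesis using True by (simp add: emeasure_eq_measure measure_le_0_iff)
  qed (use cdf in \<open>simp add: emeasure_eq_measure\<close>)
  show ?thesis
    by (rule distributedI_borel_atMost[OF _ _ _ g_eq[unfolded nn_integral_set_ennreal] M_eq]) (auto simp: spacing_density_nonneg \<alpha>)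
qed

section \<open>The logarithm of a Beta variable\<close>

lemma beta_density_eq:
  assumes m: "1 \<le> m" "m \<le> N" and r: "0 < r" "r < 1"
  shows "beta_density (real (N - m + 1)) (real m) r =
    real m * real (N choose m) * (1 - r) ^ (m - 1) * r ^ (N - m)"
proof -
  have "Beta (real (N - m + 1)) (real m) = fact (N - m) * fact (m - 1) / fact N"
    using m Gamma_fact[of "N - m", where 'a = real] Gamma_fact[of "m - 1", where 'a = real]
      Gamma_fact[of N, where 'a = real]
    by (simp add: Beta_def of_nat_diff add.commute)
  moreover have "r powr (real (N - m + 1) - 1) = r ^ (N - m)"
    using r by (simp add: powr_realpow)
  moreover have "(1 - r) powr (real m - 1) = (1 - r) ^ (m - 1)"
    using r m powr_realpow[of "1 - r" "m - 1"] by (simp add: of_nat_diff)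
  ultimately show ?thesis
    using r by (simp add: beta_density_def real_mult_binomial_eq_fact[OF m] mult_ac)
qed

text \<open>The event is that \<open>\<rho>\<close> is at least
  \<open>u = exp (- \<alpha> * x)\<close>, and \<open>- binom_tail N m (1 - r)\<close> is an
  antiderivative of the Beta density that vanishes at \<open>r = 1\<close>.\<close>

lemma (in prob_space) distributed_ln_beta:
  assumes \<alpha>: "0 < \<alpha>" and m: "1 \<le> m" "m \<le> N"
    and \<rho>: "distributed M lborel \<rho> (beta_density (real (N - m + 1)) (real m))"
  shows "distributed M lborel (\<lambda>\<omega>. - (1 / \<alpha>) * ln (\<rho> \<omega>)) (spacing_density \<alpha> N m)"
proof (rule distributed_spacing_densityI[OF \<alpha> m])
  have [measurable]: "\<rho> \<in> borel_measurable M"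
    using distributed_measurable[OF \<rho>] by simp
  show "(\<lambda>\<omega>. - (1 / \<alpha>) * ln (\<rho> \<omega>)) \<in> borel_measurable M" by measurable
  fix x :: real assume x: "0 \<le> x"
  define u where "u = exp (- \<alpha> * x)"
  have u: "0 < u" "u \<le> 1" using x \<alpha> by (auto simp: u_def)
  let ?A = "{r. - (1 / \<alpha>) * ln r \<le> x}"
  let ?b = "beta_density (real (N - m + 1)) (real m)"
  let ?f = "\<lambda>r. real m * real (N choose m) * (1 - r) ^ (m - 1) * r ^ (N - m)"
  have A: "r \<in> ?A \<longleftrightarrow> u \<le> r" if "0 < r" for r
  proof -
    have "r \<in> ?A \<longleftrightarrow> - \<alpha> * x \<le> ln r" using \<alpha> by (auto simp: field_simps)
    also have "\<dots> \<longleftrightarrow> u \<le> r" using that unfolding u_def by (simp add: ln_ge_iff)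
    finally show ?thesis .
  qed
  have "emeasure M (\<rho> -` ?A \<inter> space M) = (\<integral>\<^sup>+r. ennreal (?b r) * indicator ?A r \<partial>lborel)"
    by (rule distributed_emeasure[OF \<rho>]) measurable
  also have "\<dots> = (\<integral>\<^sup>+r. ennreal (?f r) * indicator {u..1} r \<partial>lborel)"
  \<comment> \<open>At \<open>r = 1\<close> the polynomial \<open>?f\<close> can differ from the
    density, which is 0 there. For \<open>r \<le> 0\<close> the value of \<open>ln\<close> is
    immaterial, since the density vanishes.\<close>
  proof (rule nn_integral_cong_AE, rule AE_mp[OF AE_lborel_singleton[of "1::real"]], intro AE_I2 impI)
    fix r :: real assume "r \<noteq> 1"
    show "ennreal (?b r) * indicator ?A r = ennreal (?f r) * indicator {u..1} r"
    proof (cases "0 < r \<and> r < 1")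
      case True
      then show ?thesis using A[of r] beta_density_eq[OF m, of r] by (simp add: indicator_def)
    next
      case False
      then show ?thesis using u \<open>r \<noteq> 1\<close> by (auto simp: beta_density_def indicator_def)
    qed
  qed
  also have "\<dots> = - binom_tail N m (1 - 1) - (- binom_tail N m (1 - u))"
  proof (rule nn_integral_FTC_Icc)
    fix r :: real
    have "((\<lambda>r. - binom_tail N m (1 - r)) has_real_derivative
        - ((real m * real (N choose m) * (1 - r) ^ (m - 1) * (1 - (1 - r)) ^ (N - m)) * (- 1))) (at r)"
      by (rule DERIV_minus, rule DERIV_chain2[OF has_real_derivative_binom_tail[OF m(2)]])
        (auto intro!: derivative_eq_intros)
    then show "((\<lambda>r. - binom_tail N m (1 - r)) has_real_derivative ?f r) (at r)"
      by simp
    show "0 \<le> ?f r" if "r \<in> {u..1}"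
      using u that by (auto intro!: mult_nonneg_nonneg zero_le_power)
  qed (use u in auto)
  also have "\<dots> = ennreal (binom_tail N m (1 - u))" using m by (simp add: binom_tail_0)
  finally have "emeasure M {\<omega>\<in>space M. - (1 / \<alpha>) * ln (\<rho> \<omega>) \<le> x} = ennreal (binom_tail N m (1 - u))"
    by (simp add: vimage_def Int_def conj_commute)
  moreover have "0 \<le> binom_tail N m (1 - u)"
    using u by (auto simp: binom_tail_def intro!: sum_nonneg mult_nonneg_nonneg zero_le_power)
  ultimately show "prob {\<omega>\<in>space M. - (1 / \<alpha>) * ln (\<rho> \<omega>) \<le> x} = binom_tail N m (1 - exp (- \<alpha> * x))"
    by (simp add: measure_def u_def)
qed

section \<open>Moments of the spacing density\<close>

definition spacing_moment :: "real \<Rightarrow> nat \<Rightarrow> nat \<Rightarrow> nat \<Rightarrow> real" where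
  "spacing_moment \<alpha> N k m = (\<integral>x. spacing_density \<alpha> N m x * x ^ k \<partial>lborel)"

lemma integrable_erlang_density: "0 < l \<Longrightarrow> integrable lborel (erlang_density k l)"
proof (rule integrableI_nonneg)
  assume l: "0 < l"
  interpret prob_space "density lborel (erlang_density k l)"
    by (rule prob_space_erlang_density[OF l])
  show "(\<integral>\<^sup>+x. ennreal (erlang_density k l x) \<partial>lborel) < \<infinity>"
    using emeasure_space_1 by (simp add: emeasure_density)
qed auto

text \<open>With \<open>q = exp (- \<alpha> * x)\<close>, the powers of \<open>1 - q\<close> and
  \<open>q\<close> are together at most \<open>q\<close>, and \<open>x ^ k * q\<close> is a multiple
  of the Erlang density of order \<open>k\<close>; this gives the constant
  \<open>?K\<close>.\<close>

lemma integrable_spacing_density_power: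
  assumes \<alpha>: "0 < \<alpha>"
  shows "integrable lborel (\<lambda>x. spacing_density \<alpha> N m x * x ^ k)"
proof (rule Bochner_Integration.integrable_bound)
  let ?K = "real m * real (N choose m) * fact k / \<alpha> ^ k"
  show "integrable lborel (\<lambda>x. ?K * erlang_density k \<alpha> x)"
    by (intro integrable_mult_right integrable_erlang_density \<alpha>)
  show "AE x in lborel. norm (spacing_density \<alpha> N m x * x ^ k) \<le> norm (?K * erlang_density k \<alpha> x)"
  proof (rule AE_I2)
    fix x :: real
    show "norm (spacing_density \<alpha> N m x * x ^ k) \<le> norm (?K * erlang_density k \<alpha> x)"
    proof (cases "0 < x")
      case True
      let ?q = "exp (- \<alpha> * x)"
      have q: "0 \<le> ?q" "?q \<le> 1" using True \<alpha> by auto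
      have "(1 - ?q) ^ (m - 1) * ?q ^ (N - m + 1) \<le> 1 * ?q"
        using q by (intro mult_mono power_le_one) (auto intro: mult_left_le power_le_one)
      then have "\<alpha> * (real m * real (N choose m)) * x ^ k * ((1 - ?q) ^ (m - 1) * ?q ^ (N - m + 1)) \<le>
          \<alpha> * (real m * real (N choose m)) * x ^ k * ?q"
        using \<alpha> True by (intro mult_left_mono) auto
      also have "\<dots> = ?K * erlang_density k \<alpha> x"
        using \<alpha> True by (simp add: erlang_density_def field_simps)
      finally have "spacing_density \<alpha> N m x * x ^ k \<le> ?K * erlang_density k \<alpha> x"
        using True by (simp add: spacing_density_def mult_ac)
      also have "\<dots> \<le> norm (?K * erlang_density k \<alpha> x)"
        unfolding real_norm_def by (rule abs_ge_self)
      finally show ?thesis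
        using True spacing_density_nonneg[OF \<alpha>, of N m x] by simp
    qed (simp add: spacing_density_def)
  qed
qed measurable

text \<open>Integration by parts: \<open>\<alpha> (N - m)\<close> times the function \<open>g\<close> below is the \<open>(m+1)\<close>-st density,
  and its derivative is the difference of two consecutive densities.\<close>

lemma spacing_moment_Suc:
  assumes \<alpha>: "0 < \<alpha>" and m: "m < N"
  shows "spacing_moment \<alpha> N k (Suc m) = spacing_moment \<alpha> N k m +
    real k / (\<alpha> * real (N - m)) * spacing_moment \<alpha> N (k - 1) (Suc m) + (if k = 0 \<and> m = 0 then 1 else 0)"
proof -
  define q where "q x = exp (- \<alpha> * x)" for x
  define g where "g x = real (N choose m) * (1 - q x) ^ m * q x ^ (N - m)" for x
  define g' where "g' x = \<alpha> * real (N choose m) * (real m * (1 - q x) ^ (m - 1) * q x ^ (N - m + 1)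
      - real (N - m) * (1 - q x) ^ m * q x ^ (N - m))" for x
  let ?d = "spacing_density \<alpha> N"
  let ?c = "real k / (\<alpha> * real (N - m))"
  let ?\<phi> = "\<lambda>x. real k * x ^ (k - 1) * g x + x ^ k * g' x"
  let ?\<psi> = "\<lambda>x. ?c * (?d (Suc m) x * x ^ (k - 1)) + ?d m x * x ^ k - ?d (Suc m) x * x ^ k"
  have absorb: "real (Suc m) * real (N choose Suc m) = real (N - m) * real (N choose m)"
    by (metis of_nat_mult binomial_absorption binomial_absorb_comp)
  have Nm: "N - Suc m + 1 = N - m" using m by simp
  have d_Suc: "?d (Suc m) x = \<alpha> * real (N - m) * g x" if "0 < x" for x
    using that unfolding spacing_density_def absorb Nm by (simp add: g_def q_def mult_ac)
  have d_diff: "?d m x - ?d (Suc m) x = g' x" if "0 < x" for x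
    using that unfolding spacing_density_def absorb Nm by (simp add: g'_def q_def algebra_simps)
  have \<psi>\<phi>: "?\<psi> x = ?\<phi> x" if "0 < x" for x
  proof -
    have "?\<psi> x = ?c * (?d (Suc m) x * x ^ (k - 1)) + x ^ k * (?d m x - ?d (Suc m) x)"
      by (simp add: algebra_simps)
    then show ?thesis
      unfolding d_diff[OF that] unfolding d_Suc[OF that] using \<alpha> m by simp
  qed
  \<comment> \<open>Since \<open>?\<psi>\<close> is built from densities that vanish for
    \<open>x \<le> 0\<close>, the integral over the half-line becomes one over the whole line, hence
    a combination of moments.\<close>
  have ind: "indicator (einterval 0 \<infinity>) x *\<^sub>R ?\<phi> x = ?\<psi> x" for x
  proof (cases "0 < x")
    case True
    then show ?thesis using \<psi>\<phi>[OF True] by (simp add: einterval_def)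
  qed (simp add: einterval_def spacing_density_def)
  have int: "integrable lborel ?\<psi>"
    by (intro Bochner_Integration.integrable_add Bochner_Integration.integrable_diff
        integrable_mult_right integrable_spacing_density_power[OF \<alpha>])
  \<comment> \<open>The boundary term at 0 is \<open>0 ^ k * g 0\<close>. As
    \<open>0 ^ 0 = 1\<close>, it survives exactly for \<open>k = 0\<close> and
    \<open>m = 0\<close>.\<close>
  have "(LBINT x=0..\<infinity>. ?\<phi> x) = 0 - (if k = 0 \<and> m = 0 then 1 else 0)"
  proof (rule interval_integral_FTC_integrable[where F = "\<lambda>x. x ^ k * g x"])
    show "set_integrable lborel (einterval 0 \<infinity>) ?\<phi>"
      unfolding set_integrable_def ind by (rule int)
    have g_deriv: "(g has_real_derivative g' x) (at x)" for x
    proof -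
      have "(N - m) = Suc (N - m - 1)" using m by simp
      then have "q x ^ (N - m) = q x * q x ^ (N - m - 1)" by (metis power_Suc)
      moreover have "(q has_real_derivative - \<alpha> * q x) (at x)"
        unfolding q_def by (auto intro!: derivative_eq_intros)
      ultimately show ?thesis
        unfolding g_def g'_def
        by (auto intro!: derivative_eq_intros simp: algebra_simps)
    qed
    show "((\<lambda>x. x ^ k * g x) has_vector_derivative ?\<phi> x) (at x)" for x
      unfolding has_real_derivative_iff_has_vector_derivative[symmetric]
      by (auto intro!: derivative_eq_intros g_deriv)
    show "isCont ?\<phi> x" for x
      unfolding g_def g'_def q_def by (intro continuous_intros)
    have "isCont (\<lambda>x. x ^ k * g x) 0"
      unfolding g_def q_def by (intro continuous_intros)
    then have "((\<lambda>x. x ^ k * g x) \<longlongrightarrow> 0 ^ k * g 0) (at_right 0)"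
      by (simp add: isCont_def filterlim_at_split)
    moreover have "0 ^ k * g 0 = (if k = 0 \<and> m = 0 then 1 else 0)"
      by (simp add: g_def q_def)
    ultimately show "(((\<lambda>x. x ^ k * g x) \<circ> real_of_ereal) \<longlongrightarrow> (if k = 0 \<and> m = 0 then 1 else 0)) (at_right 0)"
      by (simp add: zero_ereal_def ereal_tendsto_simps)
    have "((\<lambda>x. real (N choose m) * (x ^ k * exp (- \<alpha> * x))) \<longlongrightarrow> 0) at_top"
      using \<alpha> by real_asymp
    then have "((\<lambda>x. x ^ k * g x) \<longlongrightarrow> 0) at_top"
    proof (rule Lim_null_comparison[rotated])
      show "\<forall>\<^sub>F x in at_top. norm (x ^ k * g x) \<le> real (N choose m) * (x ^ k * exp (- \<alpha> * x))"
        using eventually_ge_at_top[of 0]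
      proof eventually_elim
        case (elim x)
        have q: "0 \<le> q x" "q x \<le> 1" using elim \<alpha> by (auto simp: q_def)
        \<comment> \<open>Here \<open>m < N\<close> matters: at least one factor \<open>q x\<close>
          is left to give decay at infinity.\<close>
        have "q x ^ (N - m) \<le> q x ^ 1" using q m by (intro power_decreasing) auto
        then have "(1 - q x) ^ m * q x ^ (N - m) \<le> 1 * q x"
          using q by (intro mult_mono power_le_one) auto
        then have "x ^ k * real (N choose m) * ((1 - q x) ^ m * q x ^ (N - m)) \<le> x ^ k * real (N choose m) * q x"
          using elim by (intro mult_left_mono) auto
        moreover have "0 \<le> x ^ k * g x" using elim q by (auto simp: g_def)
        ultimately show ?case by (simp add: g_def q_def mult_ac)
      qed
    qed
    then show "(((\<lambda>x. x ^ k * g x) \<circ> real_of_ereal) \<longlongrightarrow> 0) (at_left \<infinity>)"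
      by (simp add: ereal_tendsto_simps)
  qed simp
  moreover have "(LBINT x=0..\<infinity>. ?\<phi> x) = integral\<^sup>L lborel ?\<psi>"
    unfolding interval_lebesgue_integral_def set_lebesgue_integral_def ind by simp
  moreover have "integral\<^sup>L lborel ?\<psi> = ?c * spacing_moment \<alpha> N (k - 1) (Suc m) +
      spacing_moment \<alpha> N k m - spacing_moment \<alpha> N k (Suc m)"
    unfolding spacing_moment_def
    by (simp add: integrable_spacing_density_power[OF \<alpha>])
  ultimately show ?thesis by simp
qed

text \<open>A uniform start for the recursions, although \<open>m = 0\<close> does not give a
  probability density. The total mass 1 enters at the step from 0 to 1, through the boundary term of
  \<open>spacing_moment_Suc\<close>.\<close>

lemma spacing_moment_0: "spacing_moment \<alpha> N k 0 = 0"
proof -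
  have "spacing_density \<alpha> N 0 x = 0" for x
    by (simp add: spacing_density_def)
  then show ?thesis by (simp add: spacing_moment_def)
qed

lemma spacing_moment_total:
  assumes "0 < \<alpha>" "1 \<le> m" "m \<le> N"
  shows "spacing_moment \<alpha> N 0 m = 1"
  using assms(2,3)
proof (induction m rule: dec_induct)
  case base
  then show ?case using spacing_moment_Suc[of \<alpha> 0 N 0] assms by (simp add: spacing_moment_0)
next
  case (step m)
  then show ?case using spacing_moment_Suc[of \<alpha> m N 0] assms by simp
qed

text \<open>Because the density for \<open>Suc m\<close> has total mass 1, the step from
  \<open>m\<close> adds \<open>1 / (\<alpha> * (N - m))\<close>; the harmonic sum is built up from
  its last term.\<close>

lemma spacing_moment_mean:
  assumes "0 < \<alpha>" "m \<le> N"
  shows "spacing_moment \<alpha> N 1 m = (1 / \<alpha>) * (harm N - harm (N - m))"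
  using assms(2)
proof (induction m)
  case (Suc m)
  then have "N - m = Suc (N - Suc m)" by simp
  then have "harm (N - m) = harm (N - Suc m) + 1 / real (N - m)"
    by (simp add: harm_Suc inverse_eq_divide)
  moreover have "spacing_moment \<alpha> N 1 (Suc m) = spacing_moment \<alpha> N 1 m + 1 / (\<alpha> * real (N - m))"
    using Suc.prems assms spacing_moment_Suc[of \<alpha> m N 1] spacing_moment_total[of \<alpha> "Suc m" N]
    by simp
  ultimately show ?case
    using Suc by (simp add: right_diff_distrib distrib_left)
qed (simp add: spacing_moment_0)

text \<open>If the mean grows by \<open>c\<close>, the second moment grows by \<open>2 * c\<close>
  times the new mean, so the variance grows by exactly \<open>c\<^sup>2\<close>.\<close>

lemma spacing_moment_variance:
  assumes "0 < \<alpha>" "m \<le> N"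
  shows "spacing_moment \<alpha> N 2 m - (spacing_moment \<alpha> N 1 m)\<^sup>2 =
    (1 / \<alpha>\<^sup>2) * (gen_harm N 2 - gen_harm (N - m) 2)"
  using assms(2)
proof (induction m)
  case (Suc m)
  define c where "c = 1 / (\<alpha> * real (N - m))"
  have "N - m = Suc (N - Suc m)" using Suc.prems by simp
  then have "gen_harm (N - m) 2 = gen_harm (N - Suc m) 2 + 1 / (real (N - m))\<^sup>2"
    by (simp add: gen_harm_def)
  then have h: "(1 / \<alpha>\<^sup>2) * gen_harm (N - m) 2 = (1 / \<alpha>\<^sup>2) * gen_harm (N - Suc m) 2 + c\<^sup>2"
    by (simp add: c_def distrib_left power_mult_distrib power_divide)
  have "spacing_moment \<alpha> N 1 (Suc m) = spacing_moment \<alpha> N 1 m + c"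
    using Suc.prems assms spacing_moment_Suc[of \<alpha> m N 1] spacing_moment_total[of \<alpha> "Suc m" N]
    by (simp add: c_def)
  moreover have "spacing_moment \<alpha> N 2 (Suc m) = spacing_moment \<alpha> N 2 m + 2 * c * spacing_moment \<alpha> N 1 (Suc m)"
    using Suc.prems assms spacing_moment_Suc[of \<alpha> m N 2] by (simp add: c_def)
  ultimately have "spacing_moment \<alpha> N 2 (Suc m) - (spacing_moment \<alpha> N 1 (Suc m))\<^sup>2 =
      spacing_moment \<alpha> N 2 m - (spacing_moment \<alpha> N 1 m)\<^sup>2 + c\<^sup>2"
    by (simp add: power2_eq_square algebra_simps)
  then show ?case using Suc h by (simp add: right_diff_distrib)
qed (simp add: spacing_moment_0)

subsection \<open>Exponential and Pareto samples\<close>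

text \<open>The joint law of independent variables is the product of their laws. Restriction to the
  index set makes the vector extensional, as points of the product space are; \<open>0 < n\<close>
  provides a variable whose law is \<open>\<nu>\<close>.\<close>

lemma (in prob_space) distr_restrict_eq_sample:
  assumes indep: "indep_vars (\<lambda>_. borel) X {1..n}" and n: "0 < n"
    and law: "\<And>k. k \<in> {1..n} \<Longrightarrow> distr M borel (X k) = \<nu>"
  shows "iid_sample \<nu>" and "(\<lambda>\<omega>. \<lambda>k\<in>{1..n}. X k \<omega>) \<in> measurable M (iid_sample.sample \<nu> n)"
    and "distr M (iid_sample.sample \<nu> n) (\<lambda>\<omega>. \<lambda>k\<in>{1..n}. X k \<omega>) = iid_sample.sample \<nu> n"
proof -
  have X: "X k \<in> borel_measurable M" if "k \<in> {1..n}" for k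
    using indep that by (auto simp: indep_vars_def)
  have 1: "1 \<in> {1..n}" using n by simp
  have \<nu>: "\<nu> = distr M borel (X 1)" using law[OF 1] by simp
  interpret nu: prob_space \<nu>
    unfolding \<nu> by (rule prob_space_distr) (rule X[OF 1])
  show "iid_sample \<nu>"
    by unfold_locales (simp add: \<nu>)
  then interpret D: iid_sample \<nu> n .
  have sets: "sets D.sample = sets (Pi\<^sub>M {1..n} (\<lambda>_. borel :: real measure))"
    unfolding D.sample_def by (rule sets_PiM_cong) auto
  show meas: "(\<lambda>\<omega>. \<lambda>k\<in>{1..n}. X k \<omega>) \<in> measurable M D.sample"
    unfolding measurable_cong_sets[OF refl sets]
    by (rule measurable_restrict) (rule X)
  have "distr M D.sample (\<lambda>\<omega>. \<lambda>k\<in>{1..n}. X k \<omega>) =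
      distr M (Pi\<^sub>M {1..n} (\<lambda>_. borel)) (\<lambda>\<omega>. \<lambda>k\<in>{1..n}. X k \<omega>)"
    by (rule distr_cong) (auto simp: sets)
  also have "\<dots> = Pi\<^sub>M {1..n} (\<lambda>k. distr M borel (X k))"
    using indep indep_vars_iff_distr_eq_PiM'[where I = "{1..n}" and M' = "\<lambda>_. borel" and X = X] 1 X by auto
  also have "\<dots> = D.sample"
    unfolding D.sample_def by (rule PiM_cong) (auto simp: law)
  finally show "distr M D.sample (\<lambda>\<omega>. \<lambda>k\<in>{1..n}. X k \<omega>) = D.sample" .
qed

text \<open>Order statistics depend only on the restricted vector, so the event is a preimage under
  it. A single order statistic is covered by \<open>i = j\<close> and a \<open>Q\<close> that
  ignores one argument.\<close>

lemma (in prob_space) prob_order_stats: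
  assumes indep: "indep_vars (\<lambda>_. borel) X {1..n}"
    and ij: "1 \<le> i" "i \<le> n" "1 \<le> j" "j \<le> n"
    and law: "\<And>k. k \<in> {1..n} \<Longrightarrow> distr M borel (X k) = \<nu>"
    and h: "Measurable.pred (borel \<Otimes>\<^sub>M borel) (\<lambda>(x, y). Q x y)"
  shows "prob {\<omega>\<in>space M. Q (order_stat X i n \<omega>) (order_stat X j n \<omega>)} =
    measure (iid_sample.sample \<nu> n)
      {x\<in>space (iid_sample.sample \<nu> n). Q (iid_sample.ord n i x) (iid_sample.ord n j x)}"
proof -
  have n: "0 < n" using ij by simp
  interpret D: iid_sample \<nu> n by (rule distr_restrict_eq_sample(1)[OF indep n law])
  let ?r = "\<lambda>\<omega>. \<lambda>k\<in>{1..n}. X k \<omega>"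
  let ?E = "{x\<in>space D.sample. Q (D.ord i x) (D.ord j x)}"
  have r: "?r \<in> measurable M D.sample" by (rule distr_restrict_eq_sample(2)[OF indep n law])
  have ord: "order_stat X m n \<omega> = D.ord m (?r \<omega>)" for m \<omega>
    unfolding D.ord_def by (rule order_stat_cong) simp
  have [measurable]: "D.ord i \<in> borel_measurable D.sample" "D.ord j \<in> borel_measurable D.sample"
    using ij by (auto intro: D.measurable_ord)
  have "(\<lambda>x. (D.ord i x, D.ord j x)) \<in> measurable D.sample (borel \<Otimes>\<^sub>M borel)" by measurable
  from measurable_compose[OF this h] have E: "?E \<in> sets D.sample"
    by (simp add: pred_def)
  have "measure D.sample ?E = measure (distr M D.sample ?r) ?E"
    by (simp only: distr_restrict_eq_sample(3)[OF indep n law])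
  also have "\<dots> = prob (?r -` ?E \<inter> space M)"
    by (rule measure_distr[OF r E])
  also have "?r -` ?E \<inter> space M = {\<omega>\<in>space M. Q (order_stat X i n \<omega>) (order_stat X j n \<omega>)}"
    unfolding ord using measurable_space[OF r] by auto
  finally show ?thesis by simp
qed

lemma (in prob_space) distr_eqI_cdf:
  assumes "X \<in> borel_measurable M" "Y \<in> borel_measurable M"
    and "cdf (distr M borel X) = cdf (distr M borel Y)"
  shows "distr M borel X = distr M borel Y"
  using assms by (intro cdf_unique real_distribution_distr)

text \<open>Scaling by \<open>l\<close> turns the parameter \<open>l * \<alpha>\<close> into
  \<open>\<alpha>\<close>. Thus \<open>l = 1\<close> treats the sample with parameter
  \<open>\<alpha>\<close>, and \<open>l = 1 / \<alpha>\<close> the rescaled standard sample.\<close>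

lemma (in prob_space) distributed_exp_order_stat:
  assumes indep: "indep_vars (\<lambda>_. borel) Y {1..N}" and \<alpha>: "0 < \<alpha>" and m: "1 \<le> m" "m \<le> N" and l: "0 < l"
    and Y: "\<And>k. k \<in> {1..N} \<Longrightarrow> exp_distributed M (Y k) (l * \<alpha>)"
  shows "distributed M lborel (\<lambda>\<omega>. l * order_stat Y m N \<omega>) (spacing_density \<alpha> N m)"
proof (rule distributed_spacing_densityI[OF \<alpha> m])
  have meas: "Y k \<in> borel_measurable M" if "k \<in> {1..N}" for k
    using Y[OF that] by (simp add: exp_distributed_def)
  have 1: "1 \<in> {1..N}" using m by simp
  have [measurable]: "order_stat Y m N \<in> borel_measurable M"
    using m meas by (rule borel_measurable_order_stat)
  show "(\<lambda>\<omega>. l * order_stat Y m N \<omega>) \<in> borel_measurable M" by measurable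
  define \<nu> where "\<nu> = distr M borel (Y 1)"
  have law: "distr M borel (Y k) = \<nu>" if "k \<in> {1..N}" for k
    unfolding \<nu>_def using that Y[OF that] Y[OF 1] by (intro distr_eqI_cdf) (auto simp: exp_distributed_def)
  fix x :: real assume x: "0 \<le> x"
  interpret D: iid_sample \<nu> N
    by (rule distr_restrict_eq_sample(1)[OF indep _ law]) (use m in auto)
  have "prob {\<omega>\<in>space M. l * order_stat Y m N \<omega> \<le> x} = prob {\<omega>\<in>space M. order_stat Y m N \<omega> \<le> x / l}"
    using l by (simp add: field_simps)
  also have "\<dots> = measure D.sample {y\<in>space D.sample. D.ord m y \<le> x / l}"
    by (rule prob_order_stats[OF indep m m law, where Q = "\<lambda>y _. y \<le> x / l"]) (auto simp: case_prod_unfold)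
  also have "\<dots> = binom_tail N m (cdf \<nu> (x / l))"
    unfolding cdf_def by (rule D.measure_ord_le[OF m])
  also have "cdf \<nu> (x / l) = 1 - exp (- \<alpha> * x)"
    unfolding \<nu>_def using Y[OF 1] x l by (auto simp: exp_distributed_def mult_ac divide_le_0_iff)
  finally show "prob {\<omega>\<in>space M. l * order_stat Y m N \<omega> \<le> x} = binom_tail N m (1 - exp (- \<alpha> * x))" .
qed

lemma (in prob_space) pareto_law_gt:
  assumes "pareto_distributed M X \<alpha> \<delta>"
  shows "measure (distr M borel X) {t<..} = (if t \<le> \<delta> then 1 else (\<delta> / t) powr \<alpha>)"
proof -
  have X: "X \<in> borel_measurable M" using assms by (simp add: pareto_distributed_def)
  interpret D: prob_space "distr M borel X" by (rule prob_space_distr[OF X])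
  have "measure (distr M borel X) {t<..} = 1 - cdf (distr M borel X) t"
    using D.prob_compl[of "{..t}"] by (simp add: cdf_def Compl_eq_Diff_UNIV[symmetric])
  then show ?thesis using assms by (simp add: pareto_distributed_def)
qed

text \<open>Up to and including \<open>\<delta>\<close> the distribution function is 0; beyond it,
  it agrees near \<open>t\<close> with a continuous function and so has no jump.\<close>

lemma (in prob_space) pareto_law_singleton:
  assumes X: "pareto_distributed M X \<alpha> \<delta>" and \<delta>: "0 < \<delta>"
  shows "measure (distr M borel X) {t} = 0"
proof -
  interpret D: real_distribution "distr M borel X"
    using X by (intro real_distribution_distr) (simp add: pareto_distributed_def)
  have cdf: "cdf (distr M borel X) x = (if x \<le> \<delta> then 0 else 1 - (\<delta> / x) powr \<alpha>)" for x
    using X by (simp add: pareto_distributed_def)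
  show ?thesis
  proof (cases "t \<le> \<delta>")
    case True
    have "measure (distr M borel X) {t} \<le> measure (distr M borel X) {..t}"
      by (rule D.finite_measure_mono) auto
    also have "\<dots> = 0" using cdf[of t] True by (simp add: cdf_def)
    finally show ?thesis by (simp add: measure_le_0_iff)
  next
    case False
    have "\<forall>\<^sub>F x in nhds t. x \<in> {\<delta><..}"
      by (rule eventually_nhds_in_open) (use False in auto)
    then have "\<forall>\<^sub>F x in nhds t. cdf (distr M borel X) x = 1 - (\<delta> / x) powr \<alpha>"
      by eventually_elim (simp add: cdf)
    moreover have "isCont (\<lambda>x. 1 - (\<delta> / x) powr \<alpha>) t"
      using False \<delta> by (intro continuous_intros) auto
    ultimately show ?thesis
      unfolding D.isCont_cdf[symmetric] by (simp add: isCont_cong)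
  qed
qed

lemma (in prob_space) distributed_pareto_log_ratio:
  assumes \<alpha>: "0 < \<alpha>" and \<delta>: "0 < \<delta>" and ij: "1 \<le> i" "i < j" "j \<le> n"
    and indep: "indep_vars (\<lambda>_. borel) X {1..n}"
    and X: "\<And>k. k \<in> {1..n} \<Longrightarrow> pareto_distributed M (X k) \<alpha> \<delta>"
  shows "distributed M lborel (\<lambda>\<omega>. ln (order_stat X j n \<omega> / order_stat X i n \<omega>))
    (spacing_density \<alpha> (n - i) (j - i))"
proof (rule distributed_spacing_densityI[OF \<alpha>])
  have i: "1 \<le> i" "i \<le> n" and j: "1 \<le> j" "j \<le> n" and 1: "1 \<in> {1..n}" using ij by auto
  show "1 \<le> j - i" "j - i \<le> n - i" using ij by auto
  define \<nu> where "\<nu> = distr M borel (X 1)"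
  have meas: "X k \<in> borel_measurable M" if "k \<in> {1..n}" for k
    using X[OF that] by (simp add: pareto_distributed_def)
  have [measurable]: "order_stat X i n \<in> borel_measurable M" "order_stat X j n \<in> borel_measurable M"
    using i j meas by (auto intro: borel_measurable_order_stat)
  show "(\<lambda>\<omega>. ln (order_stat X j n \<omega> / order_stat X i n \<omega>)) \<in> borel_measurable M" by measurable
  have law: "distr M borel (X k) = \<nu>" if "k \<in> {1..n}" for k
    unfolding \<nu>_def using that X[OF that] X[OF 1] by (intro distr_eqI_cdf) (auto simp: pareto_distributed_def)
  interpret D: iid_sample \<nu> n
    by (rule distr_restrict_eq_sample(1)[OF indep _ law]) (use 1 in auto)
  interpret D: continuous_iid_sample \<nu> n
  proof unfold_locales
    show "emeasure \<nu> {t} = 0" for t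
      using pareto_law_singleton[OF X[OF 1] \<delta>, of t, folded \<nu>_def] by (simp add: D.emeasure_eq_measure)
  qed
  have AE_\<nu>: "AE t in \<nu>. \<delta> < t"
  proof (rule AE_I)
    show "emeasure \<nu> {..\<delta>} = 0"
      using X[OF 1] unfolding pareto_distributed_def \<nu>_def[symmetric]
      by (simp add: cdf_def D.emeasure_eq_measure)
  qed auto
  have "AE \<omega> in M. \<forall>k\<in>{1..n}. \<delta> < X k \<omega>"
  proof (rule AE_finite_allI)
    fix k assume k: "k \<in> {1..n}"
    have "AE t in distr M borel (X k). \<delta> < t"
      using AE_\<nu> unfolding law[OF k] .
    then show "AE \<omega> in M. \<delta> < X k \<omega>"
      using meas[OF k] by (simp add: AE_distr_iff)
  qed simp
  \<comment> \<open>Positivity of both order statistics is what permits exponentiating the logarithm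
    and clearing the denominator; it holds almost surely since the observations exceed
    \<open>\<delta>\<close>.\<close>
  then have AE_pos: "AE \<omega> in M. 0 < order_stat X i n \<omega> \<and> order_stat X i n \<omega> \<le> order_stat X j n \<omega>"
  proof eventually_elim
    case (elim \<omega>)
    then show ?case
      using order_stat_in_sample[OF i, of X \<omega>] order_stat_mono[of i j n X \<omega>] ij \<delta> by force
  qed
  fix x :: real assume x: "0 \<le> x"
  have "prob {\<omega>\<in>space M. ln (order_stat X j n \<omega> / order_stat X i n \<omega>) \<le> x} =
      prob {\<omega>\<in>space M. order_stat X j n \<omega> \<le> exp x * order_stat X i n \<omega>}"
  proof (rule measure_eq_AE)
    show "AE \<omega> in M. \<omega> \<in> {\<omega>\<in>space M. ln (order_stat X j n \<omega> / order_stat X i n \<omega>) \<le> x} \<longleftrightarrow>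
        \<omega> \<in> {\<omega>\<in>space M. order_stat X j n \<omega> \<le> exp x * order_stat X i n \<omega>}"
      using AE_pos
    proof eventually_elim
      case (elim \<omega>)
      then have "ln (order_stat X j n \<omega> / order_stat X i n \<omega>) \<le> x \<longleftrightarrow>
          order_stat X j n \<omega> / order_stat X i n \<omega> \<le> exp x"
        by (metis divide_pos_pos exp_le_cancel_iff exp_ln less_le_trans)
      also have "\<dots> \<longleftrightarrow> order_stat X j n \<omega> \<le> exp x * order_stat X i n \<omega>"
        using elim by (simp add: pos_divide_le_eq)
      finally show ?case by simp
    qed
  qed measurable
  also have "\<dots> = measure D.sample {y\<in>space D.sample. D.ord j y \<le> exp x * D.ord i y}"
    by (rule prob_order_stats[OF indep i j law, where Q = "\<lambda>y z. z \<le> exp x * y"]) (auto simp: case_prod_unfold)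
  also have "\<dots> = binom_tail (n - i) (j - i) (1 - exp (- \<alpha> * x))"
  proof (rule D.measure_ord_le_ord)
    \<comment> \<open>For \<open>t > \<delta>\<close> both \<open>t\<close> and
      \<open>exp x * t\<close> lie in the power-law range, where the ratio of the tails is
      \<open>exp (- \<alpha> * x)\<close> whatever \<open>t\<close> is. This fixes
      \<open>p = 1 - exp (- \<alpha> * x)\<close>.\<close>
    show "AE t in \<nu>. t \<le> exp x * t \<and>
        measure \<nu> {exp x * t<..} = (1 - (1 - exp (- \<alpha> * x))) * measure \<nu> {t<..}"
      using AE_\<nu>
    proof eventually_elim
      case (elim t)
      have t: "0 < t" "1 \<le> exp x" using elim \<delta> x by auto
      then have le: "t \<le> exp x * t" by simp
      have "(\<delta> / (exp x * t)) powr \<alpha> = (exp (- x) * (\<delta> / t)) powr \<alpha>"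
        by (simp add: exp_minus field_simps)
      also have "\<dots> = exp (- \<alpha> * x) * (\<delta> / t) powr \<alpha>"
        using t \<delta> by (subst powr_mult) (auto simp: powr_def)
      finally show ?case
        using le elim by (simp add: pareto_law_gt[OF X[OF 1], folded \<nu>_def])
    qed
  qed (use ij x \<alpha> in auto)
  finally show "prob {\<omega>\<in>space M. ln (order_stat X j n \<omega> / order_stat X i n \<omega>) \<le> x} =
      binom_tail (n - i) (j - i) (1 - exp (- \<alpha> * x))" .
qed

lemma (in prob_space) expectation_spacing_density:
  assumes \<alpha>: "0 < \<alpha>" and W: "distributed M lborel W (spacing_density \<alpha> N m)"
  shows "integrable M (\<lambda>\<omega>. W \<omega> ^ k)" and "expectation (\<lambda>\<omega>. W \<omega> ^ k) = spacing_moment \<alpha> N k m"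
proof -
  show "integrable M (\<lambda>\<omega>. W \<omega> ^ k)"
    using integrable_spacing_density_power[OF \<alpha>, of N m k]
      distributed_integrable[OF W, of "\<lambda>x. x ^ k"] spacing_density_nonneg[OF \<alpha>] by simp
  show "expectation (\<lambda>\<omega>. W \<omega> ^ k) = spacing_moment \<alpha> N k m"
    unfolding spacing_moment_def
    using distributed_integral[OF W, of "\<lambda>x. x ^ k"] spacing_density_nonneg[OF \<alpha>] by simp
qed

text \<open>The image measures are taken on \<open>lborel\<close> in \<open>distributed\<close> and
  on \<open>borel\<close> in \<open>eq_in_distr\<close>; they agree because the two have the same
  measurable sets.\<close>

lemma eq_in_distr_of_distributed:
  assumes "distributed M lborel X f" "distributed N lborel Y f"
  shows "eq_in_distr M X N Y"
proof -
  have lborel: "distr K borel Z = density lborel f" if "distributed K lborel Z f" for K Z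
    using distributed_distr_eq_density[OF that]
    by (metis distr_cong sets_lborel)
  then show ?thesis
    using assms distributed_measurable[OF assms(1)] distributed_measurable[OF assms(2)]
    by (simp add: eq_in_distr_def lborel[OF assms(1)] lborel[OF assms(2)])
qed

theorem theorem3:
  fixes \<alpha> \<delta> :: real and n i j :: nat
    and M :: "'a measure" and X :: "nat \<Rightarrow> 'a \<Rightarrow> real"
  assumes "0 < \<alpha>" and "0 < \<delta>" and "0 < n"
    and "1 \<le> i" and "i < j" and "j \<le> n"
    and "prob_space M"
    and "prob_space.indep_vars M (\<lambda>_. borel) X {1..n}"
    and "\<And>k. k \<in> {1..n} \<Longrightarrow> pareto_distributed M (X k) \<alpha> \<delta>"
  defines "L \<equiv> \<lambda>\<omega>. ln (order_stat X j n \<omega> / order_stat X i n \<omega>)"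
  shows "(\<forall>(B :: 'b measure) \<rho> (P :: 'c measure) Y (Q :: 'd measure) Z.
            prob_space B \<longrightarrow>
            distributed B lborel \<rho> (beta_density (real (n - j + 1)) (real (j - i))) \<longrightarrow>
            prob_space P \<longrightarrow>
            prob_space.indep_vars P (\<lambda>_. borel) Y {1..n - i} \<longrightarrow>
            (\<forall>k\<in>{1..n - i}. exp_distributed P (Y k) \<alpha>) \<longrightarrow>
            prob_space Q \<longrightarrow>
            prob_space.indep_vars Q (\<lambda>_. borel) Z {1..n - i} \<longrightarrow>
            (\<forall>k\<in>{1..n - i}. exp_distributed Q (Z k) 1) \<longrightarrow>
              eq_in_distr M L B (\<lambda>\<omega>. - (1 / \<alpha>) * ln (\<rho> \<omega>)) \<and>
              eq_in_distr B (\<lambda>\<omega>. - (1 / \<alpha>) * ln (\<rho> \<omega>)) P (order_stat Y (j - i) (n - i)) \<and>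
              eq_in_distr P (order_stat Y (j - i) (n - i))
                Q (\<lambda>\<omega>. (1 / \<alpha>) * order_stat Z (j - i) (n - i) \<omega>))
       \<and> distributed M lborel L
            (\<lambda>x. ennreal (if 0 < x
                 then \<alpha> * fact (n - i) / (fact (j - i - 1) * fact (n - j)) *
                      (1 - exp (- \<alpha> * x)) ^ (j - i - 1) * exp (- \<alpha> * x * real (n - j + 1))
                 else 0))
       \<and> prob_space.expectation M L = (1 / \<alpha>) * (harm (n - i) - harm (n - j))
       \<and> prob_space.variance M L = (1 / \<alpha>\<^sup>2) * (gen_harm (n - i) 2 - gen_harm (n - j) 2)"
proof -
  interpret M: prob_space M by fact
  note \<alpha> = \<open>0 < \<alpha>\<close>
  \<comment> \<open>The general lemmas are used with \<open>N = n - i\<close> and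
    \<open>m = j - i\<close>; \<open>nj\<close> turns the Beta parameter \<open>N - m + 1\<close>
    into \<open>n - j + 1\<close>.\<close>
  have m: "1 \<le> j - i" "j - i \<le> n - i" and nj: "n - i - (j - i) = n - j"
    using assms(4-6) by auto
  let ?f = "spacing_density \<alpha> (n - i) (j - i)"
  have L: "distributed M lborel L ?f"
    unfolding L_def by (rule M.distributed_pareto_log_ratio[where \<delta> = \<delta>]) (use assms in auto)
  have equal_laws: "eq_in_distr M L B (\<lambda>\<omega>. - (1 / \<alpha>) * ln (\<rho> \<omega>)) \<and>
      eq_in_distr B (\<lambda>\<omega>. - (1 / \<alpha>) * ln (\<rho> \<omega>)) P (order_stat Y (j - i) (n - i)) \<and>
      eq_in_distr P (order_stat Y (j - i) (n - i)) Q (\<lambda>\<omega>. (1 / \<alpha>) * order_stat Z (j - i) (n - i) \<omega>)"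
    if "prob_space B" "prob_space P" "prob_space Q"
      and \<rho>: "distributed B lborel \<rho> (beta_density (real (n - j + 1)) (real (j - i)))"
      and Y: "prob_space.indep_vars P (\<lambda>_. borel) Y {1..n - i}" "\<forall>k\<in>{1..n - i}. exp_distributed P (Y k) \<alpha>"
      and Z: "prob_space.indep_vars Q (\<lambda>_. borel) Z {1..n - i}" "\<forall>k\<in>{1..n - i}. exp_distributed Q (Z k) 1"
    for B :: "'b measure" and \<rho> and P :: "'c measure" and Y and Q :: "'d measure" and Z
  proof -
    interpret B: prob_space B by fact
    interpret P: prob_space P by fact
    interpret Q: prob_space Q by fact
    have "distributed B lborel (\<lambda>\<omega>. - (1 / \<alpha>) * ln (\<rho> \<omega>)) ?f"
      by (rule B.distributed_ln_beta[OF \<alpha> m]) (use \<rho> in \<open>simp only: nj\<close>)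
    moreover have "distributed P lborel (order_stat Y (j - i) (n - i)) ?f"
      using P.distributed_exp_order_stat[OF Y(1) \<alpha> m, of 1] Y(2) by simp
    moreover have "distributed Q lborel (\<lambda>\<omega>. (1 / \<alpha>) * order_stat Z (j - i) (n - i) \<omega>) ?f"
      using Q.distributed_exp_order_stat[OF Z(1) \<alpha> m, of "1 / \<alpha>"] Z(2) \<alpha> by simp
    ultimately show ?thesis
      using L by (blast intro: eq_in_distr_of_distributed)
  qed
  have pow: "exp (- \<alpha> * x) ^ (n - j + 1) = exp (- \<alpha> * x * real (n - j + 1))" for x
    using exp_of_nat_mult[of "n - j + 1" "- \<alpha> * x"] by (simp only: mult.commute)
  have density: "?f = (\<lambda>x. if 0 < x
      then \<alpha> * fact (n - i) / (fact (j - i - 1) * fact (n - j)) *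
        (1 - exp (- \<alpha> * x)) ^ (j - i - 1) * exp (- \<alpha> * x * real (n - j + 1))
      else 0)"
    unfolding spacing_density_def[abs_def] real_mult_binomial_eq_fact[OF m] nj pow times_divide_eq_right ..
  have "distributed M lborel L (\<lambda>x. ennreal (if 0 < x
      then \<alpha> * fact (n - i) / (fact (j - i - 1) * fact (n - j)) *
        (1 - exp (- \<alpha> * x)) ^ (j - i - 1) * exp (- \<alpha> * x * real (n - j + 1))
      else 0))"
    using L unfolding density .
  moreover have "M.expectation L = (1 / \<alpha>) * (harm (n - i) - harm (n - j))"
    using M.expectation_spacing_density(2)[OF \<alpha> L, of 1]
    unfolding spacing_moment_mean[OF \<alpha> m(2)] nj power_one_right .
  moreover have "M.variance L = (1 / \<alpha>\<^sup>2) * (gen_harm (n - i) 2 - gen_harm (n - j) 2)"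
  proof -
    have "M.variance L = spacing_moment \<alpha> (n - i) 2 (j - i) - (spacing_moment \<alpha> (n - i) 1 (j - i))\<^sup>2"
      unfolding M.expectation_spacing_density(2)[OF \<alpha> L, symmetric] power_one_right
      using M.expectation_spacing_density(1)[OF \<alpha> L, of 1] M.expectation_spacing_density(1)[OF \<alpha> L, of 2]
      by (intro M.variance_eq) (simp_all only: power_one_right)
    then show ?thesis unfolding spacing_moment_variance[OF \<alpha> m(2)] nj .
  qed
  ultimately show ?thesis
    by - (rule conjI, intro allI impI, rule equal_laws, assumption+, intro conjI)
qed

end
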